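(* Let the operators $\mathcal A(t)$, $t\ge 0$, satisfy the standing assumptions and the convergence assumption listed in the context, let $G(t,s)$ be the associated evolution operator, let $\{\mu_t:t\ge 0\}$ be a tight evolution system of measures for $G(t,s)$, and let $\mu_\infty$ be the invariant measure of the semigroup associated with the limit operator $\mathcal A_\infty$. Let $s\ge 0$, $p\in[1,+\infty)$ and $f\in C_b(\mathbb R^d)$, and put $m_s(f)=\int_{\mathbb R^d}f\,d\mu_s$. Then $G(t,s)f$ tends to $m_s(f)$ in $L^p(\mathbb R^d,\mu_\infty)$ as $t\to+\infty$.
   Context: Notation: $\mathbb R_+=[0,+\infty)$; $B_R$ is the open ball in $\mathbb R^d$ centered at $0$ with radius $R$; $C_b$ denotes bounded continuous functions. Standing assumptions. For smooth $\varphi:\mathbb R^d\to\mathbb R$ and $t\ge 0$ let $$\mathcal A(t)\varphi=\sum_{i,j=1}^d q_{ij}(t,\cdot)D_{ij}\varphi+\sum_{i=1}^d b_i(t,\cdot)D_i\varphi,$$ with $Q=(q_{ij})$, $b=(b_1,\dots,b_d)$, such that: (i) For some $\alpha\in(0,1)$ all $q_{ij},b_i$ belong to $C^{\alpha/2,1+\alpha}_{\rm loc}(\mathbb R_+\times\mathbb R^d)$ (i.e. they and their first-order spatial derivatives are locally Hölder continuous with exponent $\alpha/2$ in $t$ and $\alpha$ in $x$). Moreover $q_{ij}\in C_b(\mathbb R_+\times B_R)$ and $D_kq_{ij},b_j\in C_b(\mathbb R_+;L^{p_0}(B_R))$ for all $i,j,k\in\{1,\dots,d\}$, all $R>0$ and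 some $p_0>d+2$. (ii) $Q(t,x)$ is symmetric and $\langle Q(t,x)\xi,\xi\rangle\ge\eta(t,x)|\xi|^2$ for all $t\ge 0$, $x,\xi\in\mathbb R^d$ and a function $\eta:\mathbb R_+\times\mathbb R^d\to\mathbb R$ with $\eta_0:=\inf\eta>0$. (iii) There exist a function $0<V\in C^2(\mathbb R^d)$ and constants $a\ge 0$, $\kappa>0$ such that $V(x)\to+\infty$ as $|x|\to+\infty$ and $(\mathcal A(t)V)(x)\le a-\kappa V(x)$ for all $(t,x)\in\mathbb R_+\times\mathbb R^d$. (iv) There exist $c_0\ge 0$ and $r_0\in\mathbb R$ such that $|\nabla_xQ(t,x)|\le c_0\eta(t,x)$ and $\langle\nabla_xb(t,x)\xi,\xi\rangle\le r_0|\xi|^2$ for all $t\ge 0$, $x,\xi\in\mathbb R^d$. (v) There exists $c>0$ such that either $|Q(t,x)|\le c(1+|x|)V(x)$ and $\langle b(t,x),x\rangle\le c(1+|x|^2)V(x)$ for all $(t,x)\in\mathbb R_+\times\mathbb R^d$, or $|Q(t,x)|\le c$ for all $(t,x)\in\mathbb R_+\times\mathbb R^d$. Convergence assumption. The coefficients $q_{ij},b_i$ belong to $C_b^{\alpha/2,\alpha}(\mathbb R_+\times B_R)$ for all $i,j\in\{1,\dots,d\}$ and $R>0$ (bounded, and Hölder continuous with exponent $\alpha/2$ in $t$ and $\alpha$ in $x$, uniformly on $\mathbb R_+\times B_R$), and $Q(t,\cdot)$, $b(t,\cdot)$ converge pointwise to maps $Q_\infty:\mathbb R^d\to\mathbb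 R^{d^2}$, $b_\infty:\mathbb R^d\to\mathbb R^d$ as $t\to+\infty$. Evolution operator. For $f\in C_b(\mathbb R^d)$ and $s\ge 0$, $G(\cdot,s)f$ is the unique solution $u\in C_b([s,+\infty)\times\mathbb R^d)\cap C^{1,2}((s,+\infty)\times\mathbb R^d)$ of $D_tu=\mathcal A(t)u$ on $(s,+\infty)\times\mathbb R^d$ with $u(s,\cdot)=f$ (known to exist under these assumptions). Evolution system of measures: a family of Borel probability measures $\{\mu_t:t\ge 0\}$ on $\mathbb R^d$ with $\int_{\mathbb R^d}G(t,s)f\,d\mu_t=\int_{\mathbb R^d}f\,d\mu_s$ for all $f\in C_b(\mathbb R^d)$, $t\ge s\ge 0$. It is tight if for every $\varepsilon>0$ there is $R>0$ with $\mu_t(B_R)\ge 1-\varepsilon$ for all $t\ge 0$. Limit operator. $\mathcal A_\infty\varphi={\rm Tr}(Q_\infty D^2\varphi)+\langle b_\infty,\nabla\varphi\rangle$. Its coefficients are locally $\alpha$-Hölder continuous and satisfy the $t$-independent analogues of (ii) and (iii). For $f\in C_b(\mathbb R^d)$, $T(\cdot)f$ is the unique solution in $C_b([0,+\infty)\times\mathbb R^d)\cap C^{1,2}((0,+\infty)\times\mathbb R^d)$ of $D_tu=\mathcal A_\infty u$, $u(0,\cdot)=f$. The semigroup $T(\cdot)$ has a unique invariant measure $\mu_\infty$, i.e. a unique Borel probability measure with $\int_{\mathbb R^d}T(t)f\,d\mu_\infty=\int_{\mathbb R^d}f\,d\mu_\infty$ for all $f\in C_b(\mathbb R^d)$, $t\ge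 0$. *)

theory Defs
  imports "HOL-Probability.Probability"
begin

section \<open>Differential operators and classical solutions\<close>

definition pd :: "'n \<Rightarrow> (real^'n \<Rightarrow> real) \<Rightarrow> real^'n \<Rightarrow> real" where
  "pd i f x = deriv (\<lambda>h. f (x + h *\<^sub>R axis i 1)) 0"

definition C1_fun :: "(real^'n \<Rightarrow> real) \<Rightarrow> bool" where
  "C1_fun f \<longleftrightarrow> (\<forall>x. f differentiable (at x)) \<and> (\<forall>i. continuous_on UNIV (pd i f))"

definition C2_fun :: "(real^'n \<Rightarrow> real) \<Rightarrow> bool" where
  "C2_fun f \<longleftrightarrow> C1_fun f \<and> (\<forall>i. C1_fun (pd i f))"

definition elliptic_op ::
  "(real^'n \<Rightarrow> real^'n^'n) \<Rightarrow> (real^'n \<Rightarrow> real^'n) \<Rightarrow> (real^'n \<Rightarrow> real) \<Rightarrow> real^'n \<Rightarrow> real" where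
  "elliptic_op q \<beta> \<phi> x =
     (\<Sum>i\<in>UNIV. \<Sum>j\<in>UNIV. q x $ i $ j * pd i (pd j \<phi>) x) + (\<Sum>i\<in>UNIV. \<beta> x $ i * pd i \<phi> x)"

definition Cb_on :: "(real \<times> (real^'n)) set \<Rightarrow> (real \<Rightarrow> real^'n \<Rightarrow> real) \<Rightarrow> bool" where
  "Cb_on S u \<longleftrightarrow> continuous_on S (\<lambda>(t, x). u t x) \<and> bounded ((\<lambda>(t, x). u t x) ` S)"

text \<open>The space of functions that are once differentiable in time and twice in space on
  the set of all (t, x) with t > s, all these derivatives being jointly continuous.\<close>

definition C12_after :: "real \<Rightarrow> (real \<Rightarrow> real^'n \<Rightarrow> real) \<Rightarrow> bool" where
  "C12_after s u \<longleftrightarrow>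
     (\<forall>t>s. \<forall>x. (\<lambda>r. u r x) differentiable (at t) \<and> u t differentiable (at x) \<and>
        (\<forall>i. pd i (u t) differentiable (at x))) \<and>
     continuous_on ({s<..} \<times> UNIV) (\<lambda>(t, x). u t x) \<and>
     continuous_on ({s<..} \<times> UNIV) (\<lambda>(t, x). deriv (\<lambda>r. u r x) t) \<and>
     (\<forall>i. continuous_on ({s<..} \<times> UNIV) (\<lambda>(t, x). pd i (u t) x)) \<and>
     (\<forall>i j. continuous_on ({s<..} \<times> UNIV) (\<lambda>(t, x). pd i (pd j (u t)) x))"

definition bounded_classical_solution ::
  "(real \<Rightarrow> real^'n \<Rightarrow> real^'n^'n) \<Rightarrow> (real \<Rightarrow> real^'n \<Rightarrow> real^'n) \<Rightarrow> real \<Rightarrow> (real^'n \<Rightarrow> real) \<Rightarrow>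
   (real \<Rightarrow> real^'n \<Rightarrow> real) \<Rightarrow> bool" where
  "bounded_classical_solution Q b s f u \<longleftrightarrow>
     Cb_on ({s..} \<times> UNIV) u \<and> C12_after s u \<and>
     (\<forall>t>s. \<forall>x. deriv (\<lambda>r. u r x) t = elliptic_op (Q t) (b t) (u t) x) \<and>
     (\<forall>x. u s x = f x)"

text \<open>Values of u at times before s are irrelevant, so uniqueness only concerns times from s on.\<close>

definition is_the_bounded_classical_solution ::
  "(real \<Rightarrow> real^'n \<Rightarrow> real^'n^'n) \<Rightarrow> (real \<Rightarrow> real^'n \<Rightarrow> real^'n) \<Rightarrow> real \<Rightarrow> (real^'n \<Rightarrow> real) \<Rightarrow>
   (real \<Rightarrow> real^'n \<Rightarrow> real) \<Rightarrow> bool" where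
  "is_the_bounded_classical_solution Q b s f u \<longleftrightarrow>
     bounded_classical_solution Q b s f u \<and>
     (\<forall>v. bounded_classical_solution Q b s f v \<longrightarrow> (\<forall>t\<ge>s. \<forall>x. v t x = u t x))"

definition evolution_operator ::
  "(real \<Rightarrow> real^'n \<Rightarrow> real^'n^'n) \<Rightarrow> (real \<Rightarrow> real^'n \<Rightarrow> real^'n) \<Rightarrow>
   (real \<Rightarrow> real \<Rightarrow> (real^'n \<Rightarrow> real) \<Rightarrow> real^'n \<Rightarrow> real) \<Rightarrow> bool" where
  "evolution_operator Q b G \<longleftrightarrow>
     (\<forall>s\<ge>0. \<forall>f\<in>bcontfun. is_the_bounded_classical_solution Q b s f (\<lambda>t. G t s f))"

definition semigroup_of ::
  "(real^'n \<Rightarrow> real^'n^'n) \<Rightarrow> (real^'n \<Rightarrow> real^'n) \<Rightarrow>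
   (real \<Rightarrow> (real^'n \<Rightarrow> real) \<Rightarrow> real^'n \<Rightarrow> real) \<Rightarrow> bool" where
  "semigroup_of q \<beta> T \<longleftrightarrow>
     (\<forall>f\<in>bcontfun. is_the_bounded_classical_solution (\<lambda>_. q) (\<lambda>_. \<beta>) 0 f (\<lambda>t. T t f))"


section \<open>Evolution systems of measures and invariant measures\<close>

definition borel_prob :: "(real^'n) measure \<Rightarrow> bool" where
  "borel_prob \<mu> \<longleftrightarrow> prob_space \<mu> \<and> sets \<mu> = sets borel"

definition evolution_system_of_measures ::
  "(real \<Rightarrow> real \<Rightarrow> (real^'n \<Rightarrow> real) \<Rightarrow> real^'n \<Rightarrow> real) \<Rightarrow> (real \<Rightarrow> (real^'n) measure) \<Rightarrow> bool" where
  "evolution_system_of_measures G \<mu> \<longleftrightarrow>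
     (\<forall>t\<ge>0. borel_prob (\<mu> t)) \<and>
     (\<forall>f\<in>bcontfun. \<forall>s\<ge>0. \<forall>t\<ge>s. (\<integral>x. G t s f x \<partial>\<mu> t) = (\<integral>x. f x \<partial>\<mu> s))"

definition tight_family :: "(real \<Rightarrow> (real^'n) measure) \<Rightarrow> bool" where
  "tight_family \<mu> \<longleftrightarrow> (\<forall>\<epsilon>>0. \<exists>R>0. \<forall>t\<ge>0. measure (\<mu> t) (ball 0 R) \<ge> 1 - \<epsilon>)"

definition invariant_measure ::
  "(real \<Rightarrow> (real^'n \<Rightarrow> real) \<Rightarrow> real^'n \<Rightarrow> real) \<Rightarrow> (real^'n) measure \<Rightarrow> bool" where
  "invariant_measure T \<mu> \<longleftrightarrow>
     borel_prob \<mu> \<and> (\<forall>f\<in>bcontfun. \<forall>t\<ge>0. (\<integral>x. T t f x \<partial>\<mu>) = (\<integral>x. f x \<partial>\<mu>))"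

definition is_the_invariant_measure ::
  "(real \<Rightarrow> (real^'n \<Rightarrow> real) \<Rightarrow> real^'n \<Rightarrow> real) \<Rightarrow> (real^'n) measure \<Rightarrow> bool" where
  "is_the_invariant_measure T \<mu> \<longleftrightarrow>
     invariant_measure T \<mu> \<and> (\<forall>\<nu>. invariant_measure T \<nu> \<longrightarrow> \<nu> = \<mu>)"


section \<open>Lebesgue and parabolic Hoelder spaces\<close>

definition mem_Lp :: "real \<Rightarrow> 'a measure \<Rightarrow> ('a \<Rightarrow> real) \<Rightarrow> bool" where
  "mem_Lp p M f \<longleftrightarrow> f \<in> borel_measurable M \<and> integrable M (\<lambda>x. \<bar>f x\<bar> powr p)"

definition Lp_norm :: "real \<Rightarrow> 'a measure \<Rightarrow> ('a \<Rightarrow> real) \<Rightarrow> real" where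
  "Lp_norm p M f = (\<integral>x. \<bar>f x\<bar> powr p \<partial>M) powr (1 / p)"

text \<open>Membership is part of convergence: the Bochner integral in the norm is 0 for
  functions that are not integrable.\<close>

definition tends_in_Lp ::
  "real \<Rightarrow> 'a measure \<Rightarrow> ('t \<Rightarrow> 'a \<Rightarrow> real) \<Rightarrow> ('a \<Rightarrow> real) \<Rightarrow> 't filter \<Rightarrow> bool" where
  "tends_in_Lp p M g l F \<longleftrightarrow>
     mem_Lp p M l \<and> (\<forall>\<^sub>F t in F. mem_Lp p M (g t)) \<and>
     ((\<lambda>t. Lp_norm p M (\<lambda>x. g t x - l x)) \<longlongrightarrow> 0) F"

text \<open>Bounded continuous maps from the half-line of nonnegative times into a Lebesgue space.\<close>

definition Cb_Lp :: "real \<Rightarrow> 'a measure \<Rightarrow> (real \<Rightarrow> 'a \<Rightarrow> real) \<Rightarrow> bool" where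
  "Cb_Lp p M g \<longleftrightarrow>
     (\<forall>t\<ge>0. mem_Lp p M (g t)) \<and>
     (\<exists>K. \<forall>t\<ge>0. Lp_norm p M (g t) \<le> K) \<and>
     (\<forall>r\<ge>0. tends_in_Lp p M g (g r) (at r within {0..}))"

definition parabolic_holder_on ::
  "real \<Rightarrow> (real \<times> (real^'n)) set \<Rightarrow> (real \<Rightarrow> real^'n \<Rightarrow> real) \<Rightarrow> bool" where
  "parabolic_holder_on \<alpha> S u \<longleftrightarrow>
     (\<exists>C. \<forall>(t, x)\<in>S. \<forall>(r, y)\<in>S.
        \<bar>u t x - u r y\<bar> \<le> C * (\<bar>t - r\<bar> powr (\<alpha> / 2) + norm (x - y) powr \<alpha>))"

definition parabolic_holder_loc :: "real \<Rightarrow> (real \<Rightarrow> real^'n \<Rightarrow> real) \<Rightarrow> bool" where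
  "parabolic_holder_loc \<alpha> u \<longleftrightarrow>
     (\<forall>K. compact K \<and> K \<subseteq> {0..} \<times> UNIV \<longrightarrow> parabolic_holder_on \<alpha> K u)"

text \<open>Local parabolic Hoelder class with exponents \<open>\<alpha>/2\<close> in time and \<open>1 + \<alpha>\<close> in space.\<close>

definition parabolic_holder1_loc :: "real \<Rightarrow> (real \<Rightarrow> real^'n \<Rightarrow> real) \<Rightarrow> bool" where
  "parabolic_holder1_loc \<alpha> u \<longleftrightarrow>
     (\<forall>t\<ge>0. \<forall>x. u t differentiable (at x)) \<and>
     parabolic_holder_loc \<alpha> u \<and> (\<forall>k. parabolic_holder_loc \<alpha> (\<lambda>t. pd k (u t)))"


section \<open>Assumptions on the coefficients\<close>

text \<open>All conditions concern times \<open>t \<ge> 0\<close> only. The norm of a matrix of type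
  \<open>real^'n^'n\<close> is the Frobenius norm. Boundedness from below of \<open>\<eta>\<close> is stated
  explicitly because \<open>Inf\<close> on the reals is unspecified for sets unbounded below.\<close>

locale kolmogorov_family =
  fixes Q :: "real \<Rightarrow> real^'n \<Rightarrow> real^'n^'n"
    and b :: "real \<Rightarrow> real^'n \<Rightarrow> real^'n"
    and \<alpha> p\<^sub>0 :: real
    and \<eta> :: "real \<Rightarrow> real^'n \<Rightarrow> real"
    and V :: "real^'n \<Rightarrow> real"
    and a \<kappa> c\<^sub>0 r\<^sub>0 c :: real
  assumes alpha: "0 < \<alpha>" "\<alpha> < 1"
    and holder_Q: "\<And>i j. parabolic_holder1_loc \<alpha> (\<lambda>t x. Q t x $ i $ j)"
    and holder_b: "\<And>i. parabolic_holder1_loc \<alpha> (\<lambda>t x. b t x $ i)"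
    and p0: "p\<^sub>0 > real CARD('n) + 2"
    and Cb_Q: "\<And>i j R. R > 0 \<Longrightarrow> Cb_on ({0..} \<times> ball 0 R) (\<lambda>t x. Q t x $ i $ j)"
    and Lp_DQ: "\<And>i j k R. R > 0 \<Longrightarrow>
      Cb_Lp p\<^sub>0 (restrict_space lborel (ball 0 R)) (\<lambda>t. pd k (\<lambda>x. Q t x $ i $ j))"
    and Lp_b: "\<And>j R. R > 0 \<Longrightarrow>
      Cb_Lp p\<^sub>0 (restrict_space lborel (ball 0 R)) (\<lambda>t x. b t x $ j)"
    and sym_Q: "\<And>t x. t \<ge> 0 \<Longrightarrow> transpose (Q t x) = Q t x"
    and ellipticity: "\<And>t x \<xi>. t \<ge> 0 \<Longrightarrow> (Q t x *v \<xi>) \<bullet> \<xi> \<ge> \<eta> t x * (norm \<xi>)\<^sup>2"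
    and inf_eta: "bdd_below ((\<lambda>(t, x). \<eta> t x) ` ({0..} \<times> UNIV))"
      "(INF (t, x)\<in>{0..} \<times> UNIV. \<eta> t x) > 0"
    and V_C2: "C2_fun V" and V_pos: "\<And>x. V x > 0"
    and V_at_infinity: "filterlim V at_top at_infinity"
    and lyapunov_consts: "a \<ge> 0" "\<kappa> > 0"
    and lyapunov: "\<And>t x. t \<ge> 0 \<Longrightarrow> elliptic_op (Q t) (b t) V x \<le> a - \<kappa> * V x"
    and c0: "c\<^sub>0 \<ge> 0"
    and grad_Q: "\<And>t x. t \<ge> 0 \<Longrightarrow>
      sqrt (\<Sum>i\<in>UNIV. \<Sum>j\<in>UNIV. \<Sum>k\<in>UNIV. (pd k (\<lambda>y. Q t y $ i $ j) x)\<^sup>2) \<le> c\<^sub>0 * \<eta> t x"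
    and dissipativity: "\<And>t x \<xi>. t \<ge> 0 \<Longrightarrow>
      (\<Sum>i\<in>UNIV. \<Sum>j\<in>UNIV. pd j (\<lambda>y. b t y $ i) x * \<xi> $ j * \<xi> $ i) \<le> r\<^sub>0 * (norm \<xi>)\<^sup>2"
    and c: "c > 0"
    and growth:
      "(\<forall>t\<ge>0. \<forall>x. norm (Q t x) \<le> c * (1 + norm x) * V x \<and>
                   b t x \<bullet> x \<le> c * (1 + (norm x)\<^sup>2) * V x) \<or>
       (\<forall>t\<ge>0. \<forall>x. norm (Q t x) \<le> c)"

locale convergent_kolmogorov_family =
  kolmogorov_family Q b \<alpha> p\<^sub>0 \<eta> V a \<kappa> c\<^sub>0 r\<^sub>0 c
  for Q :: "real \<Rightarrow> real^'n \<Rightarrow> real^'n^'n" and b :: "real \<Rightarrow> real^'n \<Rightarrow> real^'n"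
    and \<alpha> p\<^sub>0 \<eta> V a \<kappa> c\<^sub>0 r\<^sub>0 c +
  fixes Qinf :: "real^'n \<Rightarrow> real^'n^'n" and binf :: "real^'n \<Rightarrow> real^'n"
  assumes Cb_holder_Q: "\<And>i j R. R > 0 \<Longrightarrow> Cb_on ({0..} \<times> ball 0 R) (\<lambda>t x. Q t x $ i $ j) \<and>
      parabolic_holder_on \<alpha> ({0..} \<times> ball 0 R) (\<lambda>t x. Q t x $ i $ j)"
    and Cb_holder_b: "\<And>i R. R > 0 \<Longrightarrow> Cb_on ({0..} \<times> ball 0 R) (\<lambda>t x. b t x $ i) \<and>
      parabolic_holder_on \<alpha> ({0..} \<times> ball 0 R) (\<lambda>t x. b t x $ i)"
    and lim_Q: "\<And>x. ((\<lambda>t. Q t x) \<longlongrightarrow> Qinf x) at_top"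
    and lim_b: "\<And>x. ((\<lambda>t. b t x) \<longlongrightarrow> binf x) at_top"

end

theory Submission
  imports Defs
begin

text \<open>The function \<open>u = G(\<cdot>, s) f\<close> forgets where it is evaluated: the difference
\<open>w(t, x, y) = u(t, x) - u(t, y)\<close> tends to 0 as \<open>t\<close> tends to infinity, locally uniformly in \<open>x\<close>
and \<open>y\<close>. This suffices. By the evolution property the mean of \<open>u(t, \<cdot>)\<close> under \<open>\<mu> t\<close> is the
constant \<open>m = \<integral> f d\<mu> s\<close>, so tightness turns the decay of \<open>w\<close> into the pointwise convergence
\<open>u(t, x) \<longlonglongrightarrow> m\<close> (\<open>tendsto_mean\<close>), and since \<open>u\<close> is bounded, dominated convergence gives the limit
in \<open>L\<^sup>p\<close> of any probability measure, in particular of the invariant measure of the limit semigroup.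

The decay of \<open>w\<close> is a coupling argument carried out with the maximum principle. A mixed second
derivative in \<open>x\<close> and \<open>y\<close> annihilates \<open>u(t, x) - u(t, y)\<close>, so \<open>w\<close> solves a parabolic equation in
twice as many variables for every choice of the mixed second-order coefficients, that is, for every
coupling of two copies of the diffusion. At a point where a bound \<open>w \<le> \<Phi>\<close> is
violated most one may choose the coupling that suits that point (\<open>two_point_comparison\<close>). Three
functions \<open>\<Phi>\<close> are used.

The Lyapunov function bounds \<open>w\<close> at infinity: a bound \<open>1 + \<beta> (V x + V y)\<close> improves with time where
\<open>V x + V y\<close> is large (\<open>lyapunov_bound\<close>). For \<open>x\<close> and \<open>y\<close> close to the origin, reflecting one
component of the noise and moving the others in parallel makes a power of the distance a strict
supersolution; as \<open>w\<close> vanishes on the diagonal, its upper bound there drops by a fixed amount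
within unit time (\<open>contraction_near_diagonal\<close>). Independent copies reach the neighbourhood of the
origin with positive probability, which in analytic terms is a Hopf barrier, so the drop spreads to
every ball (\<open>contraction_spreads\<close>). Together these give a fixed contraction of the weighted oscillation
\<open>sup w / (1 + \<beta> (V x + V y))\<close> over a fixed period, uniformly in the starting time
(\<open>weighted_contraction\<close>), in the manner of Harris' theorem for Markov chains. Uniformity in time
comes from the bounds on the coefficients that hold on every ball uniformly in \<open>t\<close>.\<close>

section \<open>Second-order expansions along lines\<close>

text \<open>The first and second derivative at 0. Differentiability is asked for only near 0 because the
comparison functions below are singular on the diagonal \<open>x = y\<close>.\<close>

definition jet2 :: "(real \<Rightarrow> real) \<Rightarrow> real \<Rightarrow> real \<Rightarrow> bool" where
  "jet2 g d1 d2 \<longleftrightarrow> (\<exists>g'. (\<forall>\<^sub>F h in nhds 0. (g has_real_derivative g' h) (at h)) \<and>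
     g' 0 = d1 \<and> (g' has_real_derivative d2) (at 0))"

lemma jet2I:
  assumes "\<And>h. (g has_real_derivative g' h) (at h)" "g' 0 = d1" "(g' has_real_derivative d2) (at 0)"
  shows "jet2 g d1 d2"
  unfolding jet2_def using assms by (intro exI[of _ g']) auto

lemma jet2_D1: "jet2 g d1 d2 \<Longrightarrow> (g has_real_derivative d1) (at 0)"
  unfolding jet2_def using eventually_nhds_x_imp_x by blast

lemma jet2_const: "jet2 (\<lambda>_. k) 0 0"
  by (rule jet2I[where g' = "\<lambda>_. 0"]) auto

lemma jet2_add:
  assumes "jet2 f f1 f2" "jet2 g g1 g2"
  shows "jet2 (\<lambda>h. f h + g h) (f1 + g1) (f2 + g2)"
proof -
  from assms obtain f' g' where *:
    "\<forall>\<^sub>F h in nhds 0. (f has_real_derivative f' h) (at h)" "f' 0 = f1" "(f' has_real_derivative f2) (at 0)"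
    "\<forall>\<^sub>F h in nhds 0. (g has_real_derivative g' h) (at h)" "g' 0 = g1" "(g' has_real_derivative g2) (at 0)"
    unfolding jet2_def by auto
  have "\<forall>\<^sub>F h in nhds 0. ((\<lambda>h. f h + g h) has_real_derivative (f' h + g' h)) (at h)"
    using *(1,4) by eventually_elim (rule DERIV_add)
  then show ?thesis
    unfolding jet2_def using * by (intro exI[of _ "\<lambda>h. f' h + g' h"]) (auto intro: DERIV_add)
qed

lemma jet2_cmult:
  assumes "jet2 f f1 f2"
  shows "jet2 (\<lambda>h. k * f h) (k * f1) (k * f2)"
proof -
  from assms obtain f' where *:
    "\<forall>\<^sub>F h in nhds 0. (f has_real_derivative f' h) (at h)" "f' 0 = f1" "(f' has_real_derivative f2) (at 0)"
    unfolding jet2_def by auto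
  have "\<forall>\<^sub>F h in nhds 0. ((\<lambda>h. k * f h) has_real_derivative (k * f' h)) (at h)"
    using *(1) by eventually_elim (rule DERIV_cmult)
  then show ?thesis
    unfolding jet2_def using * by (intro exI[of _ "\<lambda>h. k * f' h"]) (auto intro: DERIV_cmult)
qed

lemma jet2_compose:
  assumes g: "jet2 g g1 g2"
    and F: "\<forall>\<^sub>F y in nhds (g 0). (F has_real_derivative F' y) (at y)"
    and F': "(F' has_real_derivative F2) (at (g 0))"
  shows "jet2 (\<lambda>h. F (g h)) (F' (g 0) * g1) (F2 * g1\<^sup>2 + F' (g 0) * g2)"
proof -
  from g obtain g' where *:
    "\<forall>\<^sub>F h in nhds 0. (g has_real_derivative g' h) (at h)" "g' 0 = g1" "(g' has_real_derivative g2) (at 0)"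
    unfolding jet2_def by auto
  have "isCont g 0"
    using jet2_D1[OF g] DERIV_isCont by blast
  then have "filterlim g (nhds (g 0)) (nhds 0)"
    using isCont_def tendsto_nhds_iff by blast
  then have "\<forall>\<^sub>F h in nhds 0. (F has_real_derivative F' (g h)) (at (g h))"
    using F filterlim_iff by blast
  then have 1: "\<forall>\<^sub>F h in nhds 0. ((\<lambda>h. F (g h)) has_real_derivative (F' (g h) * g' h)) (at h)"
    using *(1) by eventually_elim (rule DERIV_chain2)
  have "((\<lambda>h. F' (g h)) has_real_derivative (F2 * g1)) (at 0)"
    by (rule DERIV_chain2[OF F' jet2_D1[OF g]])
  from DERIV_mult[OF this *(3)]
  have "((\<lambda>h. F' (g h) * g' h) has_real_derivative (F2 * g1\<^sup>2 + F' (g 0) * g2)) (at 0)"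
    using *(2) by (simp add: power2_eq_square algebra_simps)
  with 1 show ?thesis
    unfolding jet2_def using * by (intro exI[of _ "\<lambda>h. F' (g h) * g' h"]) auto
qed

lemma jet2_local_max:
  assumes g: "jet2 g d1 d2" and mx: "\<forall>\<^sub>F h in nhds 0. g h \<le> g 0"
  shows "d1 = 0" "d2 \<le> 0"
proof -
  from g obtain g' where *:
    "\<forall>\<^sub>F h in nhds 0. (g has_real_derivative g' h) (at h)" "g' 0 = d1" "(g' has_real_derivative d2) (at 0)"
    unfolding jet2_def by auto
  from eventually_conj[OF *(1) mx] obtain e where e: "e > 0"
    "\<And>h. \<bar>h\<bar> < e \<Longrightarrow> (g has_real_derivative g' h) (at h) \<and> g h \<le> g 0"
    unfolding eventually_nhds_metric dist_real_def by auto
  show d1: "d1 = 0"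
    using DERIV_local_max[OF jet2_D1[OF g] e(1)] e(2) by (simp add: abs_minus_commute)
  show "d2 \<le> 0"
  proof (rule ccontr)
    assume "\<not> d2 \<le> 0"
    then obtain d where d: "d > 0" "\<And>h. 0 < h \<Longrightarrow> h < d \<Longrightarrow> 0 < g' h"
      using DERIV_pos_inc_right[OF *(3)] *(2) d1 by auto
    define h where "h = min d e / 2"
    have h: "0 < h" "h < d" "h < e"
      using d(1) e(1) by (auto simp: h_def)
    have "g 0 < g h"
    proof (rule DERIV_pos_imp_increasing_open[OF h(1)])
      show "\<exists>y. (g has_real_derivative y) (at x) \<and> 0 < y" if "0 < x" "x < h" for x
        using that h e(2)[of x] d(2)[of x] by (intro exI[of _ "g' x"]) auto
      show "continuous_on {0..h} g"
        using h e(2) by (intro continuous_at_imp_continuous_on ballI)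
          (metis DERIV_isCont abs_of_nonneg atLeastAtMost_iff le_less_trans)
    qed
    with e(2)[of h] h show False by auto
  qed
qed

lemma has_derivative_pd:
  assumes "f differentiable (at x)"
  shows "(f has_derivative (\<lambda>v. \<Sum>i\<in>UNIV. v $ i * pd i f x)) (at x)"
proof -
  from assms obtain D where D: "(f has_derivative D) (at x)"
    unfolding differentiable_def by auto
  have lin: "linear D"
    using D by (simp add: has_derivative_linear)
  have pd: "pd i f x = D (axis i 1)" for i
  proof -
    have "((\<lambda>h::real. x + h *\<^sub>R axis i 1) has_derivative (\<lambda>h. h *\<^sub>R axis i 1)) (at 0)"
      by (auto intro!: derivative_eq_intros)
    from has_derivative_compose[OF this, of f D] D
    have "((\<lambda>h. f (x + h *\<^sub>R axis i 1)) has_derivative (\<lambda>h. D (h *\<^sub>R axis i 1))) (at 0)"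
      by simp
    moreover have "(\<lambda>h. D (h *\<^sub>R axis i 1)) = (*) (D (axis i 1))"
      using linear_scale[OF lin] by auto
    ultimately have "((\<lambda>h. f (x + h *\<^sub>R axis i 1)) has_real_derivative D (axis i 1)) (at 0)"
      unfolding has_field_derivative_def by simp
    then show ?thesis
      unfolding pd_def by (rule DERIV_imp_deriv)
  qed
  have "D v = (\<Sum>i\<in>UNIV. v $ i * pd i f x)" for v
  proof -
    have "v = (\<Sum>i\<in>UNIV. v $ i *\<^sub>R axis i 1)"
      by (simp add: vec_eq_iff axis_def if_distrib cong: if_cong)
    then have "D v = D (\<Sum>i\<in>UNIV. v $ i *\<^sub>R axis i 1)" by simp
    then show ?thesis
      by (simp add: linear_sum[OF lin] linear_scale[OF lin] pd)
  qed
  then have "D = (\<lambda>v. \<Sum>i\<in>UNIV. v $ i * pd i f x)" by auto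
  with D show ?thesis by simp
qed

lemma has_real_derivative_line:
  assumes "f differentiable (at (x + h *\<^sub>R \<xi>))"
  shows "((\<lambda>h. f (x + h *\<^sub>R \<xi>)) has_real_derivative (\<Sum>i\<in>UNIV. \<xi> $ i * pd i f (x + h *\<^sub>R \<xi>))) (at h)"
proof -
  have "((\<lambda>h::real. x + h *\<^sub>R \<xi>) has_derivative (\<lambda>h. h *\<^sub>R \<xi>)) (at h)"
    by (auto intro!: derivative_eq_intros)
  from has_derivative_compose[OF this has_derivative_pd[OF assms]]
  show ?thesis
    unfolding has_field_derivative_def
    by (rule has_derivative_eq_rhs) (simp add: fun_eq_iff sum_distrib_left sum_distrib_right mult_ac)
qed

lemma jet2_line:
  assumes "\<And>y. f differentiable (at y)" "\<And>j. pd j f differentiable (at x)"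
  shows "jet2 (\<lambda>h. f (x + h *\<^sub>R \<xi>)) (\<Sum>i\<in>UNIV. \<xi> $ i * pd i f x)
           (\<Sum>i\<in>UNIV. \<Sum>j\<in>UNIV. \<xi> $ i * \<xi> $ j * pd i (pd j f) x)"
proof (rule jet2I[where g' = "\<lambda>h. \<Sum>j\<in>UNIV. \<xi> $ j * pd j f (x + h *\<^sub>R \<xi>)"])
  show "((\<lambda>h. f (x + h *\<^sub>R \<xi>)) has_real_derivative (\<Sum>i\<in>UNIV. \<xi> $ i * pd i f (x + h *\<^sub>R \<xi>))) (at h)" for h
    by (rule has_real_derivative_line) (rule assms)
  have "((\<lambda>h. pd j f (x + h *\<^sub>R \<xi>)) has_real_derivative (\<Sum>i\<in>UNIV. \<xi> $ i * pd i (pd j f) x)) (at 0)" for j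
    using has_real_derivative_line[of "pd j f" x 0 \<xi>] assms(2) by simp
  then have "((\<lambda>h. \<Sum>j\<in>UNIV. \<xi> $ j * pd j f (x + h *\<^sub>R \<xi>)) has_real_derivative
      (\<Sum>j\<in>UNIV. \<xi> $ j * (\<Sum>i\<in>UNIV. \<xi> $ i * pd i (pd j f) x))) (at 0)"
    by (intro DERIV_sum DERIV_cmult) auto
  also have "(\<Sum>j\<in>UNIV. \<xi> $ j * (\<Sum>i\<in>UNIV. \<xi> $ i * pd i (pd j f) x)) =
     (\<Sum>i\<in>UNIV. \<Sum>j\<in>UNIV. \<xi> $ i * \<xi> $ j * pd i (pd j f) x)"
    by (subst sum.swap) (simp add: sum_distrib_left mult_ac)
  finally show "((\<lambda>h. \<Sum>j\<in>UNIV. \<xi> $ j * pd j f (x + h *\<^sub>R \<xi>)) has_real_derivative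
     (\<Sum>i\<in>UNIV. \<Sum>j\<in>UNIV. \<xi> $ i * \<xi> $ j * pd i (pd j f) x)) (at 0)" .
qed simp

lemma jet2_norm_square: "jet2 (\<lambda>h. (norm (x + h *\<^sub>R \<xi>))\<^sup>2) (2 * (x \<bullet> \<xi>)) (2 * (norm \<xi>)\<^sup>2)"
proof (rule jet2I[where g' = "\<lambda>h. 2 * (x \<bullet> \<xi>) + 2 * h * (norm \<xi>)\<^sup>2"])
  have *: "(norm (x + h *\<^sub>R \<xi>))\<^sup>2 = (norm x)\<^sup>2 + 2 * h * (x \<bullet> \<xi>) + h\<^sup>2 * (norm \<xi>)\<^sup>2" for h
    unfolding power2_norm_eq_inner by (simp add: algebra_simps inner_commute power2_eq_square)
  show "((\<lambda>h. (norm (x + h *\<^sub>R \<xi>))\<^sup>2) has_real_derivative (2 * (x \<bullet> \<xi>) + 2 * h * (norm \<xi>)\<^sup>2)) (at h)" for h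
    unfolding * by (auto intro!: derivative_eq_intros)
  show "((\<lambda>h. 2 * (x \<bullet> \<xi>) + 2 * h * (norm \<xi>)\<^sup>2) has_real_derivative (2 * (norm \<xi>)\<^sup>2)) (at 0)"
    by (auto intro!: derivative_eq_intros)
qed simp

section \<open>Positive semidefinite matrices as sums of squares\<close>

text \<open>The list holds the directions of a noise with covariance \<open>A\<close>. It does the work of a square root
of \<open>A\<close>, and has the advantage that factors of a sum of matrices are obtained by appending lists.\<close>

definition factors :: "real^'n^'n \<Rightarrow> (real^'n) list \<Rightarrow> bool" where
  "factors A vs \<longleftrightarrow> (\<forall>i j. A $ i $ j = (\<Sum>v\<leftarrow>vs. v $ i * v $ j))"

lemma factors_append: "factors A vs \<Longrightarrow> factors B ws \<Longrightarrow> factors (A + B) (vs @ ws)"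
  by (simp add: factors_def)

lemma factors_contract:
  assumes "factors A vs"
  shows "(\<Sum>v\<leftarrow>vs. \<Sum>i\<in>UNIV. \<Sum>j\<in>UNIV. v $ i * v $ j * M i j) = (\<Sum>i\<in>UNIV. \<Sum>j\<in>UNIV. A $ i $ j * M i j)"
proof -
  have "(\<Sum>v\<leftarrow>vs. \<Sum>i\<in>UNIV. \<Sum>j\<in>UNIV. v $ i * v $ j * M i j) =
     (\<Sum>i\<in>UNIV. \<Sum>j\<in>UNIV. (\<Sum>v\<leftarrow>vs. v $ i * v $ j) * M i j)"
    by (induction vs) (simp_all add: sum.distrib algebra_simps)
  with assms show ?thesis by (simp add: factors_def)
qed

lemma quadratic_form_sum:
  "(A *v \<xi>) \<bullet> \<zeta> = (\<Sum>i\<in>UNIV. \<Sum>j\<in>UNIV. (A $ i $ j) * (\<xi> $ j * \<zeta> $ i :: real))"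
  by (simp add: inner_vec_def matrix_vector_mult_def sum_distrib_right sum_distrib_left mult_ac)

lemma factors_inner:
  assumes "factors A vs"
  shows "(\<Sum>v\<leftarrow>vs. (x \<bullet> v)\<^sup>2) = (A *v x) \<bullet> x"
proof -
  have "(x \<bullet> v)\<^sup>2 = (\<Sum>i\<in>UNIV. \<Sum>j\<in>UNIV. v $ i * v $ j * (x $ j * x $ i))" for v
    by (simp add: inner_vec_def power2_eq_square sum_product mult_ac)
  then show ?thesis
    by (simp add: factors_contract[OF assms] quadratic_form_sum)
qed

lemma factors_norm:
  assumes "factors A vs"
  shows "(\<Sum>v\<leftarrow>vs. (norm v)\<^sup>2) = trace A"
proof -
  have "(\<Sum>v\<leftarrow>vs. (norm v)\<^sup>2) = (\<Sum>i\<in>UNIV. (\<Sum>v\<leftarrow>vs. v $ i * v $ i))"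
    by (induction vs) (simp_all add: sum.distrib power2_norm_eq_inner inner_vec_def)
  with assms show ?thesis by (simp add: factors_def trace_def)
qed

lemma quadratic_form_swap:
  fixes A :: "real^'n^'n"
  assumes "transpose A = A"
  shows "(A *v \<xi>) \<bullet> \<zeta> = (A *v \<zeta>) \<bullet> \<xi>"
  by (metis assms dot_lmul_matrix inner_commute transpose_matrix_vector)

text \<open>Completing the square: subtracting the rank-one matrix made from a row with nonzero diagonal entry
leaves a positive semidefinite matrix in which that row vanishes. A row with zero diagonal entry
already vanishes, since otherwise the quadratic form would take negative values.\<close>

lemma positive_semidefinite_factors_aux:
  fixes A :: "real^'n^'n"
  assumes "finite S"
  shows "transpose A = A \<Longrightarrow> (\<And>\<xi>. 0 \<le> (A *v \<xi>) \<bullet> \<xi>) \<Longrightarrow> (\<And>i j. i \<notin> S \<Longrightarrow> A $ i $ j = 0) \<Longrightarrow>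
    \<exists>vs. factors A vs"
  using assms
proof (induction S arbitrary: A rule: finite_induct)
  case empty
  then show ?case by (intro exI[of _ "[]"]) (simp add: factors_def)
next
  case (insert k S)
  have sym: "A $ i $ j = A $ j $ i" for i j
    by (metis insert.prems(1) transpose_def vec_lambda_beta)
  have ek: "(A *v axis k 1) \<bullet> \<xi> = (\<Sum>j\<in>UNIV. A $ k $ j * \<xi> $ j)" for \<xi>
    using quadratic_form_swap[OF insert.prems(1), of "axis k 1" \<xi>]
    by (simp add: inner_axis matrix_vector_mult_def)
  have kk: "(A *v axis k 1) \<bullet> axis k 1 = A $ k $ k"
    unfolding ek by (simp add: axis_def if_distrib cong: if_cong)
  have kj: "(A *v axis k 1) \<bullet> axis j 1 = A $ k $ j" for j
    unfolding ek by (simp add: axis_def if_distrib cong: if_cong)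
  have expand: "(A *v (\<xi> - t *\<^sub>R axis k 1)) \<bullet> (\<xi> - t *\<^sub>R axis k 1) =
      (A *v \<xi>) \<bullet> \<xi> - 2 * t * ((A *v axis k 1) \<bullet> \<xi>) + t\<^sup>2 * (A $ k $ k)" for \<xi> t
    using quadratic_form_swap[OF insert.prems(1), of \<xi> "axis k 1"]
    by (simp add: matrix_vector_mult_diff_distrib inner_diff_left inner_diff_right
         matrix_vector_mult_scaleR power2_eq_square kk algebra_simps)
  have akk: "0 \<le> A $ k $ k"
    using insert.prems(2)[of "axis k 1"] kk by simp
  show ?case
  proof (cases "A $ k $ k = 0")
    case True
    have "A $ k $ j = 0" for j
    proof (rule ccontr)
      assume n: "A $ k $ j \<noteq> 0"
      \<comment> \<open>The quadratic form at \<open>axis j 1 - t *\<^sub>R axis k 1\<close> is affine in \<open>t\<close>; this \<open>t\<close> makes it \<open>-1\<close>.\<close>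
      define t where "t = ((A *v axis j 1) \<bullet> axis j 1 + 1) / (2 * A $ k $ j)"
      have "0 \<le> (A *v axis j 1) \<bullet> axis j 1 - 2 * t * (A $ k $ j)"
        using insert.prems(2)[of "axis j 1 - t *\<^sub>R axis k 1"] expand[of "axis j 1" t] True kj[of j] by simp
      also have "2 * t * (A $ k $ j) = (A *v axis j 1) \<bullet> axis j 1 + 1" using n by (simp add: t_def)
      finally show False by simp
    qed
    then have "A $ i $ j = 0" if "i \<notin> S" for i j
      using insert.prems(3) that by (cases "i = k") auto
    with insert.IH[of A] insert.prems show ?thesis by blast
  next
    case False
    with akk have pos: "0 < A $ k $ k" by simp
    define v where "v = (1 / sqrt (A $ k $ k)) *\<^sub>R A $ k"
    define B where "B = (\<chi> i j. A $ i $ j - v $ i * v $ j)"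
    have vv: "v $ i * v $ j = A $ k $ i * A $ k $ j / A $ k $ k" for i j
      using pos by (simp add: v_def field_simps)
    have "transpose B = B"
      by (simp add: transpose_def B_def vec_eq_iff sym mult.commute)
    moreover have "0 \<le> (B *v \<xi>) \<bullet> \<xi>" for \<xi>
    proof -
      let ?t = "((A *v axis k 1) \<bullet> \<xi>) / A $ k $ k"
      have "(B *v \<xi>) \<bullet> \<xi> = (A *v \<xi>) \<bullet> \<xi> - (\<Sum>i\<in>UNIV. \<Sum>j\<in>UNIV. (v $ i * v $ j) * (\<xi> $ j * \<xi> $ i))"
        by (simp add: quadratic_form_sum B_def left_diff_distrib sum_subtractf)
      also have "(\<Sum>i\<in>UNIV. \<Sum>j\<in>UNIV. (v $ i * v $ j) * (\<xi> $ j * \<xi> $ i)) = ((A *v axis k 1) \<bullet> \<xi>)\<^sup>2 / A $ k $ k"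
        unfolding vv ek power2_eq_square sum_product sum_divide_distrib by (simp add: mult_ac)
      also have "(A *v \<xi>) \<bullet> \<xi> - ((A *v axis k 1) \<bullet> \<xi>)\<^sup>2 / A $ k $ k =
          (A *v (\<xi> - ?t *\<^sub>R axis k 1)) \<bullet> (\<xi> - ?t *\<^sub>R axis k 1)"
        unfolding expand using pos by (simp add: power2_eq_square field_simps)
      finally show ?thesis using insert.prems(2) by simp
    qed
    moreover have "B $ i $ j = 0" if "i \<notin> S" for i j
      using that pos insert.prems(3)[of i] sym[of k i] by (cases "i = k") (auto simp: B_def vv)
    ultimately obtain vs where "factors B vs"
      using insert.IH by blast
    then have "factors A (v # vs)"
      by (simp add: factors_def B_def algebra_simps)
    then show ?thesis by blast
  qed
qed

lemma positive_semidefinite_factors: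
  fixes A :: "real^'n^'n"
  assumes "transpose A = A" "\<And>\<xi>. 0 \<le> (A *v \<xi>) \<bullet> \<xi>"
  obtains vs where "factors A vs"
  using positive_semidefinite_factors_aux[OF finite[of UNIV] assms] by blast

section \<open>The two-point maximum principle\<close>

text \<open>The pairs in \<open>ps\<close> are the directions in which the two copies of the diffusion move together; they
encode an arbitrary coupling of \<open>Q t x\<close> and \<open>Q t y\<close>, that is, a positive semidefinite block matrix
with these two diagonal blocks. The coupling may depend on the point in any way, which is why it is
bound inside the definition.\<close>

definition strict_supersolution_at ::
  "(real \<Rightarrow> real^'n \<Rightarrow> real^'n^'n) \<Rightarrow> (real \<Rightarrow> real^'n \<Rightarrow> real^'n) \<Rightarrow>
   (real \<Rightarrow> real^'n \<Rightarrow> real^'n \<Rightarrow> real) \<Rightarrow> real \<Rightarrow> real^'n \<Rightarrow> real^'n \<Rightarrow> bool" where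
  "strict_supersolution_at Q b \<Phi> t x y \<longleftrightarrow> (\<exists>ps D1 D2 d.
     factors (Q t x) (map fst ps) \<and> factors (Q t y) (map snd ps) \<and>
     (\<forall>\<xi> \<zeta>. jet2 (\<lambda>h. \<Phi> t (x + h *\<^sub>R \<xi>) (y + h *\<^sub>R \<zeta>)) (D1 \<xi> \<zeta>) (D2 \<xi> \<zeta>)) \<and>
     ((\<lambda>r. \<Phi> r x y) has_real_derivative d) (at t) \<and>
     (\<Sum>(\<xi>, \<zeta>)\<leftarrow>ps. D2 \<xi> \<zeta>) + D1 (b t x) (b t y) < d)"

lemma elliptic_op_factors:
  assumes "factors (q x) vs"
  shows "elliptic_op q \<beta> \<phi> x = (\<Sum>v\<leftarrow>vs. \<Sum>i\<in>UNIV. \<Sum>j\<in>UNIV. v $ i * v $ j * pd i (pd j \<phi>) x)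
    + (\<Sum>i\<in>UNIV. \<beta> x $ i * pd i \<phi> x)"
  unfolding elliptic_op_def factors_contract[OF assms] ..

lemma eventually_line_in_ball:
  fixes x \<xi> :: "real^'n"
  assumes "norm x < P"
  shows "\<forall>\<^sub>F h in nhds 0. norm (x + h *\<^sub>R \<xi>) < P"
proof -
  have "((\<lambda>h::real. norm (x + h *\<^sub>R \<xi>)) \<longlongrightarrow> norm (x + 0 *\<^sub>R \<xi>)) (nhds 0)"
    by (intro tendsto_intros filterlim_ident)
  then have "((\<lambda>h::real. norm (x + h *\<^sub>R \<xi>)) \<longlongrightarrow> norm x) (nhds 0)" by simp
  then show ?thesis using assms by (rule order_tendstoD(2))
qed

text \<open>At a positive maximum of \<open>u t x - u t y - \<theta> * \<Phi> t x y\<close> the second derivatives along all pairs of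
directions are nonpositive and the first ones vanish. Summed over the pairs of a coupling, the second
derivatives of the \<open>u\<close>-terms are exactly the second-order parts of the elliptic operator, because
\<open>u t x - u t y\<close> has no mixed derivatives. The time derivative at the maximum is nonnegative, which
contradicts strictness. The supersolution property is only demanded where the desired inequality
fails; this makes initial and lateral boundary conditions, and the exclusion of the diagonal, part of
the same assumption.\<close>

lemma two_point_comparison:
  fixes u :: "real \<Rightarrow> real^'n \<Rightarrow> real"
  assumes smooth: "C12_after s u"
    and pde: "\<And>t x. s < t \<Longrightarrow> deriv (\<lambda>r. u r x) t = elliptic_op (Q t) (b t) (u t) x"
    and st: "s < t0" and \<theta>: "0 < \<theta>"
    and cont: "continuous_on ({t0..t1} \<times> cball 0 P \<times> cball 0 P) (\<lambda>(t, x, y). \<Phi> t x y)"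
    and bad: "\<And>t x y. t0 \<le> t \<Longrightarrow> t \<le> t1 \<Longrightarrow> norm x \<le> P \<Longrightarrow> norm y \<le> P \<Longrightarrow> \<theta> * \<Phi> t x y < u t x - u t y \<Longrightarrow>
       t0 < t \<and> norm x < P \<and> norm y < P \<and> strict_supersolution_at Q b \<Phi> t x y"
    and "t0 \<le> t" "t \<le> t1" "norm x \<le> P" "norm y \<le> P"
  shows "u t x - u t y \<le> \<theta> * \<Phi> t x y"
proof (rule ccontr)
  assume "\<not> ?thesis"
  then have pos: "0 < u t x - u t y - \<theta> * \<Phi> t x y" by simp
  define K where "K = {t0..t1} \<times> cball (0::real^'n) P \<times> cball (0::real^'n) P"
  define F where "F = (\<lambda>(t, x, y). u t x - u t y - \<theta> * \<Phi> t x y)"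
  have smooth':
    "\<And>t x. s < t \<Longrightarrow> (\<lambda>r. u r x) differentiable (at t)"
    "\<And>t x. s < t \<Longrightarrow> u t differentiable (at x)"
    "\<And>t x i. s < t \<Longrightarrow> pd i (u t) differentiable (at x)"
    "continuous_on ({s<..} \<times> UNIV) (\<lambda>(t, x). u t x)"
    using smooth unfolding C12_after_def by auto
  have "continuous_on K (\<lambda>z. case (fst z, fst (snd z)) of (t, x) \<Rightarrow> u t x)"
    by (rule continuous_on_compose2[OF smooth'(4)]) (use st in \<open>auto simp: K_def intro!: continuous_intros\<close>)
  moreover have "continuous_on K (\<lambda>z. case (fst z, snd (snd z)) of (t, x) \<Rightarrow> u t x)"
    by (rule continuous_on_compose2[OF smooth'(4)]) (use st in \<open>auto simp: K_def intro!: continuous_intros\<close>)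
  ultimately have "continuous_on K F"
    using cont unfolding F_def case_prod_unfold K_def[symmetric] by (auto intro!: continuous_intros)
  moreover have "compact K" "(t, x, y) \<in> K"
    using assms(7-10) by (auto simp: K_def intro!: compact_Times)
  ultimately obtain z where "z \<in> K" "\<And>z'. z' \<in> K \<Longrightarrow> F z' \<le> F z"
    using continuous_attains_sup[of K F] by blast
  then obtain T X Y where m: "(T, X, Y) \<in> K" "\<And>z. z \<in> K \<Longrightarrow> F z \<le> F (T, X, Y)"
    by (cases z) auto
  have "0 < F (T, X, Y)"
    using m(2)[OF \<open>(t, x, y) \<in> K\<close>] pos by (simp add: F_def)
  then have in': "t0 < T" "norm X < P" "norm Y < P" "strict_supersolution_at Q b \<Phi> T X Y"
    using bad[of T X Y] m(1) by (auto simp: K_def F_def)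
  have T: "T \<le> t1" "s < T" using m(1) st in' by (auto simp: K_def)
  obtain ps D1 D2 d where d:
    "factors (Q T X) (map fst ps)" "factors (Q T Y) (map snd ps)"
    "\<And>\<xi> \<zeta>. jet2 (\<lambda>h. \<Phi> T (X + h *\<^sub>R \<xi>) (Y + h *\<^sub>R \<zeta>)) (D1 \<xi> \<zeta>) (D2 \<xi> \<zeta>)"
    "((\<lambda>r. \<Phi> r X Y) has_real_derivative d) (at T)"
    "(\<Sum>(\<xi>, \<zeta>)\<leftarrow>ps. D2 \<xi> \<zeta>) + D1 (b T X) (b T Y) < d"
    using in'(4) unfolding strict_supersolution_at_def by blast
  define H where "H \<xi> x = (\<Sum>i\<in>UNIV. \<Sum>j\<in>UNIV. \<xi> $ i * \<xi> $ j * pd i (pd j (u T)) x)" for \<xi> x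
  define L where "L \<xi> x = (\<Sum>i\<in>UNIV. \<xi> $ i * pd i (u T) x)" for \<xi> x
  have jet: "jet2 (\<lambda>h. u T (X + h *\<^sub>R \<xi>) + (- 1) * u T (Y + h *\<^sub>R \<zeta>) + (- \<theta>) * \<Phi> T (X + h *\<^sub>R \<xi>) (Y + h *\<^sub>R \<zeta>))
      (L \<xi> X + (- 1) * L \<zeta> Y + (- \<theta>) * D1 \<xi> \<zeta>) (H \<xi> X + (- 1) * H \<zeta> Y + (- \<theta>) * D2 \<xi> \<zeta>)" for \<xi> \<zeta>
    unfolding H_def L_def
    by (intro jet2_add jet2_cmult jet2_line d(3)) (use smooth' T in auto)
  have mx: "\<forall>\<^sub>F h in nhds 0. u T (X + h *\<^sub>R \<xi>) + (- 1) * u T (Y + h *\<^sub>R \<zeta>) + (- \<theta>) * \<Phi> T (X + h *\<^sub>R \<xi>) (Y + h *\<^sub>R \<zeta>)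
      \<le> u T (X + 0 *\<^sub>R \<xi>) + (- 1) * u T (Y + 0 *\<^sub>R \<zeta>) + (- \<theta>) * \<Phi> T (X + 0 *\<^sub>R \<xi>) (Y + 0 *\<^sub>R \<zeta>)" for \<xi> \<zeta>
    using eventually_line_in_ball[OF in'(2), of \<xi>] eventually_line_in_ball[OF in'(3), of \<zeta>]
  proof eventually_elim
    case (elim h)
    then show ?case
      using m(2)[of "(T, X + h *\<^sub>R \<xi>, Y + h *\<^sub>R \<zeta>)"] in'(1) T by (simp add: K_def F_def)
  qed
  have L: "L \<xi> X - L \<zeta> Y = \<theta> * D1 \<xi> \<zeta>" and H: "H \<xi> X - H \<zeta> Y - \<theta> * D2 \<xi> \<zeta> \<le> 0" for \<xi> \<zeta>
    using jet2_local_max[OF jet mx, of \<xi> \<zeta>] by simp_all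
  have eX: "elliptic_op (Q T) (b T) (u T) X = (\<Sum>p\<leftarrow>ps. H (fst p) X) + L (b T X) X"
    unfolding elliptic_op_factors[where q = "Q T" and x = X, OF d(1)] H_def L_def list.map_comp o_def ..
  have eY: "elliptic_op (Q T) (b T) (u T) Y = (\<Sum>p\<leftarrow>ps. H (snd p) Y) + L (b T Y) Y"
    unfolding elliptic_op_factors[where q = "Q T" and x = Y, OF d(2)] H_def L_def list.map_comp o_def ..
  have "elliptic_op (Q T) (b T) (u T) X - elliptic_op (Q T) (b T) (u T) Y =
      (\<Sum>p\<leftarrow>ps. H (fst p) X - H (snd p) Y) + \<theta> * D1 (b T X) (b T Y)"
    unfolding eX eY sum_list_subtractf using L[of "b T X" "b T Y"] by linarith
  also have "(\<Sum>p\<leftarrow>ps. H (fst p) X - H (snd p) Y) \<le> (\<Sum>p\<leftarrow>ps. \<theta> * D2 (fst p) (snd p))"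
  proof (rule sum_list_mono)
    fix p show "H (fst p) X - H (snd p) Y \<le> \<theta> * D2 (fst p) (snd p)"
      using H[of "fst p" "snd p"] by linarith
  qed
  also have "(\<Sum>p\<leftarrow>ps. \<theta> * D2 (fst p) (snd p)) = \<theta> * (\<Sum>(\<xi>, \<zeta>)\<leftarrow>ps. D2 \<xi> \<zeta>)"
    unfolding sum_list_const_mult case_prod_unfold ..
  also have "\<theta> * (\<Sum>(\<xi>, \<zeta>)\<leftarrow>ps. D2 \<xi> \<zeta>) + \<theta> * D1 (b T X) (b T Y) < \<theta> * d"
    unfolding distrib_left[symmetric] by (rule mult_strict_left_mono[OF d(5) \<theta>])
  finally have less: "deriv (\<lambda>r. u r X) T - deriv (\<lambda>r. u r Y) T - \<theta> * d < 0"
    using pde[OF T(2)] by simp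
  have "((\<lambda>r. u r x) has_real_derivative deriv (\<lambda>r. u r x) T) (at T)" for x
    using smooth'(1)[OF T(2)] DERIV_deriv_iff_real_differentiable by blast
  then have "((\<lambda>r. u r X - u r Y - \<theta> * \<Phi> r X Y) has_real_derivative
      (deriv (\<lambda>r. u r X) T - deriv (\<lambda>r. u r Y) T - \<theta> * d)) (at T)"
    by (intro DERIV_diff DERIV_cmult d(4))
  from DERIV_neg_dec_left[OF this less] obtain e where e: "e > 0"
    "\<And>h. 0 < h \<Longrightarrow> h < e \<Longrightarrow> F (T, X, Y) < F (T - h, X, Y)"
    unfolding F_def by auto
  define h where "h = min e (T - t0) / 2"
  have h: "0 < h" "h < e" "h < T - t0" using e(1) in'(1) by (auto simp: h_def)
  have "(T - h, X, Y) \<in> K"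
    using h m(1) by (auto simp: K_def)
  from m(2)[OF this] e(2)[OF h(1,2)] show False by linarith
qed

section \<open>Couplings of the diffusion matrices\<close>

lemma factors_append_zeros: "factors A vs \<Longrightarrow> factors A (vs @ map (\<lambda>_. 0) ws)"
  by (simp add: factors_def o_def)

lemma factors_zeros_append: "factors A vs \<Longrightarrow> factors A (map (\<lambda>_. 0) ws @ vs)"
  by (simp add: factors_def o_def)

text \<open>The independent coupling, in which each direction moves only one of the two points.\<close>

lemma strict_supersolution_independentI:
  assumes "factors (Q t x) vs" "factors (Q t y) ws"
    and "\<And>\<xi> \<zeta>. jet2 (\<lambda>h. \<Phi> t (x + h *\<^sub>R \<xi>) (y + h *\<^sub>R \<zeta>)) (D1 \<xi> \<zeta>) (D2 \<xi> \<zeta>)"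
    and "((\<lambda>r. \<Phi> r x y) has_real_derivative d) (at t)"
    and "(\<Sum>v\<leftarrow>vs. D2 v 0) + (\<Sum>w\<leftarrow>ws. D2 0 w) + D1 (b t x) (b t y) < d"
  shows "strict_supersolution_at Q b \<Phi> t x y"
proof -
  let ?ps = "map (\<lambda>v. (v, 0)) vs @ map (\<lambda>w. (0, w)) ws"
  have "factors (Q t x) (map fst ?ps)" "factors (Q t y) (map snd ?ps)"
    using factors_append_zeros[OF assms(1), of ws] factors_zeros_append[OF assms(2), of vs]
    by (simp_all add: o_def)
  moreover have "(\<Sum>(\<xi>, \<zeta>)\<leftarrow>?ps. D2 \<xi> \<zeta>) = (\<Sum>v\<leftarrow>vs. D2 v 0) + (\<Sum>w\<leftarrow>ws. D2 0 w)"
    by (simp add: o_def)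
  ultimately show ?thesis
    unfolding strict_supersolution_at_def using assms(3-5)
    by (intro exI[of _ ?ps] exI[of _ D1] exI[of _ D2] exI[of _ d]) auto
qed

text \<open>Let \<open>f\<close> be the multiple of \<open>z\<close> with \<open>|f|\<^sup>2 = e / 2\<close>. Then \<open>A\<close> is the sum of
\<open>A - f f\<^sup>T - l I\<close>, \<open>f f\<^sup>T\<close> and \<open>l I\<close>, while \<open>B\<close> is the sum of the same first two matrices and of
\<open>B - A + l I\<close>; all of these are positive semidefinite. The first part moves both points in parallel, the
second one is reflected, the remainders are independent. The reflected part contributes \<open>2 e\<close> to the
relative motion, all of it along \<open>z\<close>; the other parts contribute at most a multiple of \<open>l\<close>. A relative
motion that is mostly along \<open>z\<close> makes concave powers of \<open>|z|\<close> supersolutions, whereas the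
components orthogonal to \<open>z\<close> tend to increase \<open>|z|\<close>.\<close>

lemma mirror_coupling:
  fixes A B :: "real^'n^'n" and z :: "real^'n"
  assumes sym: "transpose A = A" "transpose B = B"
    and ell: "\<And>\<xi>. e * (norm \<xi>)\<^sup>2 \<le> (A *v \<xi>) \<bullet> \<xi>" and e: "0 < e"
    and close: "\<And>i j. \<bar>A $ i $ j - B $ i $ j\<bar> \<le> \<omega>"
    and \<omega>: "(real CARD('n))\<^sup>2 * \<omega> \<le> l" "l \<le> e / 2"
    and z: "z \<noteq> 0"
  obtains ps where "factors A (map fst ps)" "factors B (map snd ps)"
    "(\<Sum>p\<leftarrow>ps. (norm (fst p - snd p))\<^sup>2) \<le> 2 * e + 3 * real CARD('n) * l"
    "(\<Sum>p\<leftarrow>ps. (z \<bullet> (fst p - snd p))\<^sup>2) \<ge> 2 * e * (norm z)\<^sup>2"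
proof -
  let ?n = "real CARD('n)"
  have n1: "1 \<le> ?n" by (simp add: Suc_le_eq)
  have \<omega>0: "0 \<le> \<omega>" using close[of undefined undefined] by linarith
  have l0: "0 \<le> l" using \<omega>(1) \<omega>0 by (smt (verit) mult_nonneg_nonneg zero_le_power2)
  define f where "f = (sqrt (e / 2) / norm z) *\<^sub>R z"
  define F where "F = (\<chi> i j. f $ i * f $ j)"
  have f2: "(norm f)\<^sup>2 = e / 2"
    using z e by (simp add: f_def power_mult_distrib)
  have F: "factors F [f]" "factors F [- f]"
    by (simp_all add: factors_def F_def)
  have Fq: "(F *v \<xi>) \<bullet> \<xi> \<le> e / 2 * (norm \<xi>)\<^sup>2" for \<xi>
  proof -
    have "(F *v \<xi>) \<bullet> \<xi> = (\<xi> \<bullet> f)\<^sup>2" using factors_inner[OF F(1), of \<xi>] by simp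
    also have "\<dots> \<le> (norm \<xi> * norm f)\<^sup>2"
      using Cauchy_Schwarz_ineq2[of \<xi> f] by (metis abs_ge_zero power2_abs power_mono)
    finally show ?thesis by (simp add: power_mult_distrib f2 mult.commute)
  qed
  have lq: "(mat l *v \<xi>) \<bullet> \<xi> = l * (norm \<xi>)\<^sup>2" for \<xi> :: "real^'n"
  proof -
    have "mat l *v \<xi> = l *\<^sub>R \<xi>"
      by (simp add: vec_eq_iff matrix_vector_mult_def mat_def mult_delta_left)
    then show ?thesis by (simp add: power2_norm_eq_inner)
  qed
  have Dq: "\<bar>((B - A) *v \<xi>) \<bullet> \<xi>\<bar> \<le> l * (norm \<xi>)\<^sup>2" for \<xi>
  proof -
    have "\<bar>((B - A) *v \<xi>) \<bullet> \<xi>\<bar> \<le> (\<Sum>i\<in>UNIV. \<Sum>j\<in>UNIV. \<bar>(B - A) $ i $ j * (\<xi> $ j * \<xi> $ i)\<bar>)"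
      unfolding quadratic_form_sum by (intro order_trans[OF sum_abs] sum_mono order_refl)
    also have "\<dots> \<le> (\<Sum>i\<in>(UNIV::'n set). \<Sum>j\<in>(UNIV::'n set). \<omega> * (norm \<xi>)\<^sup>2)"
    proof (intro sum_mono)
      fix i j :: 'n
      have "\<bar>\<xi> $ j\<bar> * \<bar>\<xi> $ i\<bar> \<le> norm \<xi> * norm \<xi>"
        by (intro mult_mono component_le_norm_cart) auto
      moreover have "\<bar>(B - A) $ i $ j\<bar> \<le> \<omega>" using close[of i j] by (simp add: abs_minus_commute)
      ultimately show "\<bar>(B - A) $ i $ j * (\<xi> $ j * \<xi> $ i)\<bar> \<le> \<omega> * (norm \<xi>)\<^sup>2"
        unfolding abs_mult power2_eq_square using \<omega>0 by (intro mult_mono[of _ \<omega> "_ * _"]) auto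
    qed
    also have "\<dots> = ?n\<^sup>2 * \<omega> * (norm \<xi>)\<^sup>2" by (simp add: power2_eq_square)
    also have "\<dots> \<le> l * (norm \<xi>)\<^sup>2" by (intro mult_right_mono \<omega>) auto
    finally show ?thesis .
  qed
  have F_sym: "transpose F = F" by (simp add: F_def transpose_def vec_eq_iff mult.commute)
  have tr_diff: "transpose (X - Y) = transpose X - transpose Y" for X Y :: "real^'n^'n"
    by (simp add: transpose_def vec_eq_iff)
  have tr_add: "transpose (X + Y) = transpose X + transpose Y" for X Y :: "real^'n^'n"
    by (simp add: transpose_def vec_eq_iff)
  obtain fs where fs: "factors (A - F - mat l) fs"
  proof (rule positive_semidefinite_factors)
    show "transpose (A - F - mat l) = A - F - mat l"
      by (simp add: tr_diff sym F_sym transpose_mat)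
    show "0 \<le> ((A - F - mat l) *v \<xi>) \<bullet> \<xi>" for \<xi>
    proof -
      have "l * (norm \<xi>)\<^sup>2 \<le> e / 2 * (norm \<xi>)\<^sup>2" by (intro mult_right_mono \<omega>) auto
      then show ?thesis
        using ell[of \<xi>] Fq[of \<xi>]
        by (simp add: matrix_vector_mult_diff_rdistrib inner_diff_left lq)
    qed
  qed
  obtain gs where gs: "factors (mat l :: real^'n^'n) gs"
    by (rule positive_semidefinite_factors[of "mat l"]) (auto simp: transpose_mat lq l0)
  obtain hs where hs: "factors (B - A + mat l) hs"
  proof (rule positive_semidefinite_factors)
    show "transpose (B - A + mat l) = B - A + mat l"
      by (simp add: tr_diff tr_add sym transpose_mat)
    show "0 \<le> ((B - A + mat l) *v \<xi>) \<bullet> \<xi>" for \<xi>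
      using Dq[of \<xi>] by (simp add: matrix_vector_mult_add_rdistrib inner_add_left lq abs_le_iff)
  qed
  define ps where "ps = map (\<lambda>v. (v, v)) fs @ [(f, - f)] @ map (\<lambda>v. (v, 0)) gs @ map (\<lambda>v. (0, v)) hs"
  have "factors A (map fst ps)"
    using factors_append[OF fs factors_append[OF F(1) factors_append_zeros[OF gs, of hs]]]
    by (simp add: ps_def o_def)
  moreover have "factors B (map snd ps)"
    using factors_append[OF fs factors_append[OF F(2) factors_zeros_append[OF hs, of gs]]]
    by (simp add: ps_def o_def)
  moreover have "(\<Sum>p\<leftarrow>ps. (norm (fst p - snd p))\<^sup>2) \<le> 2 * e + 3 * ?n * l"
  proof -
    have "(\<Sum>p\<leftarrow>ps. (norm (fst p - snd p))\<^sup>2) = (norm (2 *\<^sub>R f))\<^sup>2 + trace (mat l :: real^'n^'n) + trace (B - A + mat l)"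
      by (simp add: ps_def o_def factors_norm[OF gs, symmetric] factors_norm[OF hs, symmetric] scaleR_2)
    also have "(norm (2 *\<^sub>R f))\<^sup>2 = 2 * e" by (simp add: power_mult_distrib f2)
    also have "trace (mat l :: real^'n^'n) = ?n * l" by (simp add: trace_def mat_def)
    also have "trace (B - A + mat l) = (\<Sum>i\<in>UNIV. B $ i $ i - A $ i $ i) + ?n * l"
      by (simp add: trace_def mat_def sum.distrib)
    also have "(\<Sum>i\<in>UNIV. B $ i $ i - A $ i $ i) \<le> (\<Sum>i\<in>(UNIV::'n set). \<omega>)"
      by (intro sum_mono) (use close in \<open>force simp: abs_le_iff\<close>)
    also have "(\<Sum>i\<in>(UNIV::'n set). \<omega>) \<le> ?n * l"
    proof -
      have "1 * \<omega> \<le> ?n\<^sup>2 * \<omega>" using n1 \<omega>0 by (intro mult_right_mono) auto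
      then have "\<omega> \<le> l" using \<omega> by linarith
      then show ?thesis by (simp add: mult_left_mono)
    qed
    finally show ?thesis by (simp add: algebra_simps)
  qed
  moreover have "(\<Sum>p\<leftarrow>ps. (z \<bullet> (fst p - snd p))\<^sup>2) \<ge> 2 * e * (norm z)\<^sup>2"
  proof -
    have "z \<bullet> (2 *\<^sub>R f) = 2 * sqrt (e / 2) * norm z"
      using z by (simp add: f_def power2_norm_eq_inner[symmetric] power2_eq_square)
    then have "2 * e * (norm z)\<^sup>2 = (z \<bullet> (2 *\<^sub>R f))\<^sup>2"
      using e by (simp add: power_mult_distrib)
    also have "\<dots> \<le> (z \<bullet> (2 *\<^sub>R f))\<^sup>2 + (\<Sum>v\<leftarrow>gs. (z \<bullet> v)\<^sup>2) + (\<Sum>v\<leftarrow>hs. (z \<bullet> v)\<^sup>2)"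
      by (intro add_increasing2 sum_list_nonneg) auto
    also have "\<dots> = (\<Sum>p\<leftarrow>ps. (z \<bullet> (fst p - snd p))\<^sup>2)"
      by (simp add: ps_def o_def scaleR_2)
    finally show ?thesis .
  qed
  ultimately show thesis by (rule that)
qed

section \<open>Coefficient bounds that are uniform in time\<close>

lemma Cb_on_bound:
  assumes "Cb_on S g"
  obtains K where "\<And>t x. (t, x) \<in> S \<Longrightarrow> \<bar>g t x\<bar> \<le> K"
proof -
  from assms obtain K where "\<forall>z\<in>S. norm (case z of (t, x) \<Rightarrow> g t x) \<le> K"
    unfolding Cb_on_def bounded_iff by auto
  then show thesis using that[of K] by fastforce
qed

context convergent_kolmogorov_family
begin

lemma uniformly_elliptic:
  obtains e where "0 < e" "\<And>t x \<xi>. 0 \<le> t \<Longrightarrow> e * (norm \<xi>)\<^sup>2 \<le> (Q t x *v \<xi>) \<bullet> \<xi>"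
proof
  let ?e = "INF (t, x)\<in>{0..} \<times> UNIV. \<eta> t x"
  show "0 < ?e" by (rule inf_eta)
  fix t x and \<xi> :: "real^'n" assume t: "(0::real) \<le> t"
  have "?e \<le> (case (t, x) of (t, x) \<Rightarrow> \<eta> t x)"
    by (rule cINF_lower[OF inf_eta(1)]) (use t in auto)
  then have "?e * (norm \<xi>)\<^sup>2 \<le> \<eta> t x * (norm \<xi>)\<^sup>2"
    by (intro mult_right_mono) auto
  then show "?e * (norm \<xi>)\<^sup>2 \<le> (Q t x *v \<xi>) \<bullet> \<xi>"
    using ellipticity[OF t, of x \<xi>] by linarith
qed

lemma Q_factors:
  assumes "0 \<le> t"
  obtains vs where "factors (Q t x) vs"
proof -
  obtain e where e: "0 < e" "\<And>t x \<xi>. 0 \<le> t \<Longrightarrow> e * (norm \<xi>)\<^sup>2 \<le> (Q t x *v \<xi>) \<bullet> \<xi>"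
    using uniformly_elliptic by blast
  have "0 \<le> (Q t x *v \<xi>) \<bullet> \<xi>" for \<xi>
    using e(1) e(2)[OF assms, of \<xi> x] by (smt (verit) mult_nonneg_nonneg zero_le_power2)
  then show thesis
    using positive_semidefinite_factors[of "Q t x"] sym_Q[OF assms] that by blast
qed

lemma locally_bounded_coefficients:
  assumes "0 < R"
  obtains K where "0 < K" "\<And>t x. 0 \<le> t \<Longrightarrow> norm x < R \<Longrightarrow> trace (Q t x) \<le> K"
    "\<And>t x. 0 \<le> t \<Longrightarrow> norm x < R \<Longrightarrow> norm (b t x) \<le> K"
proof -
  have "\<exists>K. \<forall>t x. 0 \<le> t \<longrightarrow> norm x < R \<longrightarrow> \<bar>Q t x $ i $ i\<bar> \<le> K" for i
  proof -
    obtain K where K: "\<And>t x. (t, x) \<in> {0..} \<times> ball 0 R \<Longrightarrow> \<bar>Q t x $ i $ i\<bar> \<le> K"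
      using Cb_on_bound[OF conjunct1[OF Cb_holder_Q[OF assms]]] by blast
    show ?thesis by (intro exI[of _ K]) (use K in simp)
  qed
  then obtain k where k: "\<And>i t x. 0 \<le> t \<Longrightarrow> norm x < R \<Longrightarrow> \<bar>Q t x $ i $ i\<bar> \<le> k i" by metis
  have "\<exists>K. \<forall>t x. 0 \<le> t \<longrightarrow> norm x < R \<longrightarrow> \<bar>b t x $ i\<bar> \<le> K" for i
  proof -
    obtain K where K: "\<And>t x. (t, x) \<in> {0..} \<times> ball 0 R \<Longrightarrow> \<bar>b t x $ i\<bar> \<le> K"
      using Cb_on_bound[OF conjunct1[OF Cb_holder_b[OF assms]]] by blast
    show ?thesis by (intro exI[of _ K]) (use K in simp)
  qed
  then obtain m where m: "\<And>i t x. 0 \<le> t \<Longrightarrow> norm x < R \<Longrightarrow> \<bar>b t x $ i\<bar> \<le> m i" by metis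
  define K where "K = max 1 (max (\<Sum>i\<in>UNIV. k i) (\<Sum>i\<in>UNIV. m i))"
  show thesis
  proof
    show "0 < K" by (simp add: K_def)
    fix t :: real and x :: "real^'n" assume tx: "0 \<le> t" "norm x < R"
    have "trace (Q t x) \<le> (\<Sum>i\<in>UNIV. k i)"
      unfolding trace_def by (intro sum_mono) (use k[OF tx] in \<open>simp add: abs_le_iff\<close>)
    then show "trace (Q t x) \<le> K" by (simp add: K_def)
    have "norm (b t x) \<le> (\<Sum>i\<in>UNIV. m i)"
      by (rule order_trans[OF norm_le_l1_cart]) (intro sum_mono m[OF tx])
    then show "norm (b t x) \<le> K" by (simp add: K_def)
  qed
qed

lemma locally_uniformly_continuous_Q:
  assumes "0 < R" "0 < \<omega>"
  obtains \<rho> where "0 < \<rho>"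
    "\<And>t x y i j. 0 \<le> t \<Longrightarrow> norm x < R \<Longrightarrow> norm y < R \<Longrightarrow> norm (x - y) \<le> \<rho> \<Longrightarrow>
       \<bar>Q t x $ i $ j - Q t y $ i $ j\<bar> \<le> \<omega>"
proof -
  have "\<exists>C. \<forall>t x y. 0 \<le> t \<longrightarrow> norm x < R \<longrightarrow> norm y < R \<longrightarrow>
      \<bar>Q t x $ i $ j - Q t y $ i $ j\<bar> \<le> C * norm (x - y) powr \<alpha>" for i j
  proof -
    obtain C where C: "\<forall>(t, x)\<in>{0..} \<times> ball 0 R. \<forall>(r, y)\<in>{0..} \<times> ball 0 R.
        \<bar>Q t x $ i $ j - Q r y $ i $ j\<bar> \<le> C * (\<bar>t - r\<bar> powr (\<alpha> / 2) + norm (x - y) powr \<alpha>)"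
      using Cb_holder_Q[OF assms(1), of i j] unfolding parabolic_holder_on_def by blast
    have "\<bar>Q t x $ i $ j - Q t y $ i $ j\<bar> \<le> C * norm (x - y) powr \<alpha>"
      if "0 \<le> t" "norm x < R" "norm y < R" for t :: real and x y
    proof -
      have "(t, x) \<in> {0..} \<times> ball 0 R" "(t, y) \<in> {0..} \<times> ball 0 R" using that by auto
      then have "\<bar>Q t x $ i $ j - Q t y $ i $ j\<bar> \<le> C * (\<bar>t - t\<bar> powr (\<alpha> / 2) + norm (x - y) powr \<alpha>)"
        using C by blast
      then show ?thesis by simp
    qed
    then show ?thesis by blast
  qed
  then obtain C where C: "\<And>i j t x y. 0 \<le> t \<Longrightarrow> norm x < R \<Longrightarrow> norm y < R \<Longrightarrow>
      \<bar>Q t x $ i $ j - Q t y $ i $ j\<bar> \<le> C i j * norm (x - y) powr \<alpha>" by metis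
  define M where "M = 1 + (\<Sum>i\<in>UNIV. \<Sum>j\<in>UNIV. \<bar>C i j\<bar>)"
  have CM: "C i j \<le> M" for i j
  proof -
    have "\<bar>C i j\<bar> \<le> (\<Sum>j\<in>UNIV. \<bar>C i j\<bar>)" by (rule member_le_sum) auto
    also have "\<dots> \<le> (\<Sum>i\<in>UNIV. \<Sum>j\<in>UNIV. \<bar>C i j\<bar>)"
      by (rule member_le_sum[of i UNIV "\<lambda>i. \<Sum>j\<in>UNIV. \<bar>C i j\<bar>"]) (auto intro: sum_nonneg)
    finally show ?thesis by (simp add: M_def)
  qed
  have M: "0 < M" unfolding M_def by (intro add_pos_nonneg sum_nonneg) auto
  define \<rho> where "\<rho> = (\<omega> / M) powr (1 / \<alpha>)"
  show thesis
  proof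
    show "0 < \<rho>" using M assms by (simp add: \<rho>_def)
    fix t :: real and x y :: "real^'n" and i j
    assume *: "0 \<le> t" "norm x < R" "norm y < R" "norm (x - y) \<le> \<rho>"
    have "norm (x - y) powr \<alpha> \<le> \<rho> powr \<alpha>" using * alpha by (intro powr_mono2) auto
    also have "\<dots> = \<omega> / M" using M assms alpha by (simp add: \<rho>_def powr_powr)
    finally have "M * norm (x - y) powr \<alpha> \<le> \<omega>" using M by (simp add: field_simps)
    moreover have "C i j * norm (x - y) powr \<alpha> \<le> M * norm (x - y) powr \<alpha>"
      by (intro mult_right_mono CM) auto
    ultimately show "\<bar>Q t x $ i $ j - Q t y $ i $ j\<bar> \<le> \<omega>"
      using C[OF *(1-3), of i j] by linarith
  qed
qed

end

section \<open>Three comparison functions\<close>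

locale bounded_solution =
  convergent_kolmogorov_family Q b \<alpha> p\<^sub>0 \<eta> V a \<kappa> c\<^sub>0 r\<^sub>0 c Qinf binf
  for Q :: "real \<Rightarrow> real^'n \<Rightarrow> real^'n^'n" and b :: "real \<Rightarrow> real^'n \<Rightarrow> real^'n"
    and \<alpha> p\<^sub>0 \<eta> V a \<kappa> c\<^sub>0 r\<^sub>0 c Qinf binf +
  fixes s :: real and u :: "real \<Rightarrow> real^'n \<Rightarrow> real" and U :: real
  assumes s_nonneg: "0 \<le> s"
    and smooth: "C12_after s u"
    and pde: "\<And>t x. s < t \<Longrightarrow> deriv (\<lambda>r. u r x) t = elliptic_op (Q t) (b t) (u t) x"
    and bound: "\<And>t x. s \<le> t \<Longrightarrow> \<bar>u t x\<bar> \<le> U"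
begin

lemma V_differentiable: "V differentiable (at x)" "pd j V differentiable (at x)"
  using V_C2 by (auto simp: C2_fun_def C1_fun_def)

lemma V_continuous: "continuous_on S V"
  by (meson V_differentiable(1) continuous_at_imp_continuous_on differentiable_imp_continuous_within)

text \<open>With the independent coupling, \<open>V x + V y\<close> satisfies the drift condition with \<open>2 * a\<close> in place of
\<open>a\<close>. The constant \<open>2 * a + 1\<close> instead of \<open>2 * a\<close> makes the inequality strict. Since \<open>u\<close> is
bounded and \<open>V\<close> tends to infinity, the bound can only fail inside a ball.\<close>

lemma lyapunov_bound:
  assumes \<theta>: "0 < \<theta>" and \<beta>: "0 < \<beta>" and t0: "s < t0" and t: "t0 \<le> t"
    and init: "\<And>x y. u t0 x - u t0 y \<le> \<theta> * (1 + \<beta> * (V x + V y))"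
  shows "u t x - u t y \<le> \<theta> * (1 + \<beta> * (exp (- \<kappa> * (t - t0)) * (V x + V y)
           + (2 * a + 1) / \<kappa> * (1 - exp (- \<kappa> * (t - t0)))))"
proof -
  define k where "k = (2 * a + 1) / \<kappa>"
  have k: "0 < k" "\<kappa> * k = 2 * a + 1" using lyapunov_consts by (simp_all add: k_def)
  define E where "E r = exp (- \<kappa> * (r - t0))" for r
  define \<Phi> where "\<Phi> = (\<lambda>r x y. 1 + \<beta> * (E r * (V x + V y) + k * (1 - E r)))"
  have E: "0 < E r" for r by (simp add: E_def)
  have E1: "E r \<le> 1" if "t0 \<le> r" for r using lyapunov_consts that by (simp add: E_def)
  obtain P0 where P0: "\<And>x. P0 \<le> norm x \<Longrightarrow> 2 * U / (\<theta> * \<beta> * E t) \<le> V x"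
    using V_at_infinity unfolding filterlim_at_top eventually_at_infinity by meson
  define P where "P = max P0 (max (norm x) (norm y))"
  have "u t x - u t y \<le> \<theta> * \<Phi> t x y"
  proof (rule two_point_comparison[OF smooth pde t0 \<theta>, where ?t1.0 = t and P = P])
    show "continuous_on ({t0..t} \<times> cball 0 P \<times> cball 0 P) (\<lambda>(t, x, y). \<Phi> t x y)"
      unfolding \<Phi>_def E_def case_prod_unfold
      by (intro continuous_intros continuous_on_compose2[OF V_continuous[of UNIV]]) auto
    fix r x y
    assume *: "t0 \<le> r" "r \<le> t" "norm x \<le> P" "norm y \<le> P" "\<theta> * \<Phi> r x y < u r x - u r y"
    have r: "0 \<le> r" "s \<le> r" using * s_nonneg t0 by auto
    have "t0 \<noteq> r"
      using *(5) init[of x y] by (auto simp: \<Phi>_def E_def)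
    moreover have far: "P0 > norm z" if "V z < V x + V y" for z
    proof (rule ccontr)
      assume "\<not> ?thesis"
      then have "2 * U / (\<theta> * \<beta> * E t) \<le> V z" by (intro P0) auto
      then have "2 * U \<le> \<theta> * \<beta> * E t * V z" using \<theta> \<beta> E by (simp add: field_simps)
      also have "\<dots> \<le> \<theta> * \<beta> * E r * (V x + V y)"
        using \<theta> \<beta> E that V_pos[of z] * lyapunov_consts by (intro mult_mono mult_nonneg_nonneg) (auto simp: E_def less_imp_le)
      also have "\<dots> \<le> \<theta> * \<Phi> r x y"
      proof -
        have "\<beta> * (E r * (V x + V y)) \<le> \<Phi> r x y"
          using \<beta> k E1[OF *(1)] by (simp add: \<Phi>_def distrib_left)
        then show ?thesis using \<theta> by (simp add: mult.assoc)
      qed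
      also have "\<dots> < u r x - u r y" by fact
      also have "\<dots> \<le> 2 * U" using bound[OF r(2), of x] bound[OF r(2), of y] by linarith
      finally show False by simp
    qed
    moreover have "norm x < P" "norm y < P"
      using far[of x] far[of y] V_pos[of x] V_pos[of y] by (auto simp: P_def)
    moreover have "strict_supersolution_at Q b \<Phi> r x y"
    proof -
      obtain vs where vs: "factors (Q r x) vs" using Q_factors[OF r(1)] by blast
      obtain ws where ws: "factors (Q r y) ws" using Q_factors[OF r(1)] by blast
      define L where "L \<xi> x = (\<Sum>i\<in>UNIV. \<xi> $ i * pd i V x)" for \<xi> x
      define H where "H \<xi> x = (\<Sum>i\<in>UNIV. \<Sum>j\<in>UNIV. \<xi> $ i * \<xi> $ j * pd i (pd j V) x)" for \<xi> x
      have jV: "jet2 (\<lambda>h. V (x + h *\<^sub>R \<xi>)) (L \<xi> x) (H \<xi> x)" for \<xi> x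
        unfolding L_def H_def by (intro jet2_line V_differentiable)
      have H0: "H 0 x = 0" for x by (simp add: H_def)
      show ?thesis
      proof (rule strict_supersolution_independentI[where Q = Q and t = r and x = x and y = y and
          ?D1.0 = "\<lambda>\<xi> \<zeta>. 0 + \<beta> * (E r * (L \<xi> x + L \<zeta> y) + 0)" and
          ?D2.0 = "\<lambda>\<xi> \<zeta>. 0 + \<beta> * (E r * (H \<xi> x + H \<zeta> y) + 0)", OF vs ws])
        show "jet2 (\<lambda>h. \<Phi> r (x + h *\<^sub>R \<xi>) (y + h *\<^sub>R \<zeta>)) (0 + \<beta> * (E r * (L \<xi> x + L \<zeta> y) + 0))
            (0 + \<beta> * (E r * (H \<xi> x + H \<zeta> y) + 0))" for \<xi> \<zeta>
          unfolding \<Phi>_def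
          by (rule jet2_add[OF jet2_const jet2_cmult[OF jet2_add[OF jet2_cmult[OF jet2_add[OF jV jV]] jet2_const]]])
        show "((\<lambda>r. \<Phi> r x y) has_real_derivative (\<beta> * (E r * (\<kappa> * k - \<kappa> * (V x + V y))))) (at r)"
          unfolding \<Phi>_def E_def by (auto intro!: derivative_eq_intros simp: algebra_simps)
        have "(\<Sum>v\<leftarrow>vs. 0 + \<beta> * (E r * (H v x + H 0 y) + 0)) + (\<Sum>w\<leftarrow>ws. 0 + \<beta> * (E r * (H 0 x + H w y) + 0))
          + (0 + \<beta> * (E r * (L (b r x) x + L (b r y) y) + 0)) =
          \<beta> * (E r * (elliptic_op (Q r) (b r) V x + elliptic_op (Q r) (b r) V y))"
          unfolding elliptic_op_factors[where q = "Q r" and x = x, OF vs]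
            elliptic_op_factors[where q = "Q r" and x = y, OF ws] L_def[symmetric] H_def[symmetric]
          by (simp add: H0 sum_list_const_mult algebra_simps)
        also have "\<dots> < \<beta> * (E r * (\<kappa> * k - \<kappa> * (V x + V y)))"
          using \<beta> E[of r] lyapunov[OF r(1), of x] lyapunov[OF r(1), of y]
          by (intro mult_strict_left_mono) (auto simp: k algebra_simps)
        finally show "(\<Sum>v\<leftarrow>vs. 0 + \<beta> * (E r * (H v x + H 0 y) + 0)) + (\<Sum>w\<leftarrow>ws. 0 + \<beta> * (E r * (H 0 x + H w y) + 0))
          + (0 + \<beta> * (E r * (L (b r x) x + L (b r y) y) + 0)) < \<beta> * (E r * (\<kappa> * k - \<kappa> * (V x + V y)))" .
      qed
    qed
    ultimately show "t0 < r \<and> norm x < P \<and> norm y < P \<and> strict_supersolution_at Q b \<Phi> r x y"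
      using *(1) by auto
  qed (use t in \<open>auto simp: P_def\<close>)
  then show ?thesis by (simp add: \<Phi>_def E_def k_def)
qed

text \<open>The comparison function contains \<open>A * sqrt |x - y|\<close>, written as a power of \<open>|x - y|\<^sup>2\<close>. Under
the mirror coupling the second-order terms applied to it are at most a negative multiple of
\<open>|x - y| powr (- 3 / 2)\<close>, hence can be made to dominate the decrease \<open>\<nu>\<close> in time, the drift, and
the term \<open>(|x|\<^sup>2 + |y|\<^sup>2) / 2\<close> which shields the lateral boundary of a small ball. On the diagonal
nothing has to be checked because \<open>u t x - u t y\<close> vanishes there while the comparison function stays
nonnegative, thanks to \<open>1 \<le> M\<close>. For \<open>x\<close> and \<open>y\<close> very close to 0, the terms in space are smaller
than what has been gained in time.\<close>

lemma contraction_near_diagonal: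
  obtains \<sigma> \<delta> where "0 < \<sigma>" "0 < \<delta>"
    "\<And>\<theta> M t0 x y. 0 < \<theta> \<Longrightarrow> 1 \<le> M \<Longrightarrow> s < t0 \<Longrightarrow>
      (\<And>t x y. t0 \<le> t \<Longrightarrow> t \<le> t0 + 1 \<Longrightarrow> norm x \<le> 1 \<Longrightarrow> norm y \<le> 1 \<Longrightarrow> u t x - u t y \<le> \<theta> * M) \<Longrightarrow>
      norm x \<le> \<sigma> \<Longrightarrow> norm y \<le> \<sigma> \<Longrightarrow> u (t0 + 1) x - u (t0 + 1) y \<le> \<theta> * (M - \<delta>)"
proof -
  define n where "n = real CARD('n)"
  have n: "1 \<le> n" by (simp add: n_def Suc_le_eq)
  obtain e where e: "0 < e" "\<And>t x \<xi>. 0 \<le> t \<Longrightarrow> e * (norm \<xi>)\<^sup>2 \<le> (Q t x *v \<xi>) \<bullet> \<xi>"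
    using uniformly_elliptic by blast
  obtain K where K: "0 < K" "\<And>t x. 0 \<le> t \<Longrightarrow> norm x < 2 \<Longrightarrow> trace (Q t x) \<le> K"
    "\<And>t x. 0 \<le> t \<Longrightarrow> norm x < 2 \<Longrightarrow> norm (b t x) \<le> K"
    using locally_bounded_coefficients[of 2] by auto
  \<comment> \<open>With this \<open>l\<close> the relative motion has total size at most \<open>9 e / 4\<close>, of which \<open>2 e\<close> lies along \<open>x - y\<close>.\<close>
  define l where "l = e / (12 * n)"
  have l: "l \<le> e / 2" "3 * n * l = e / 4" "0 < l / n\<^sup>2"
    using e n by (auto simp: l_def field_simps)
  obtain \<rho>1 where \<rho>1: "0 < \<rho>1"
    "\<And>t x y i j. 0 \<le> t \<Longrightarrow> norm x < 2 \<Longrightarrow> norm y < 2 \<Longrightarrow> norm (x - y) \<le> \<rho>1 \<Longrightarrow>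
       \<bar>Q t x $ i $ j - Q t y $ i $ j\<bar> \<le> l / n\<^sup>2"
    using locally_uniformly_continuous_Q[of 2 "l / n\<^sup>2"] l by auto
  define \<rho> where "\<rho> = min (1 / 2) (min (\<rho>1 / 2) (e / (16 * K)))"
  have \<rho>: "0 < \<rho>" "2 * \<rho> \<le> 1" "2 * \<rho> \<le> \<rho>1" "2 * \<rho> * K \<le> e / 8"
  proof -
    show "0 < \<rho>" "2 * \<rho> \<le> 1" "2 * \<rho> \<le> \<rho>1" using \<rho>1 e K by (auto simp: \<rho>_def)
    have "\<rho> \<le> e / (16 * K)" by (simp add: \<rho>_def)
    then show "2 * \<rho> * K \<le> e / 8" using K(1) by (simp add: field_simps)
  qed
  \<comment> \<open>The decrease in unit time equals the least value of the shielding term on the lateral boundary.\<close>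
  define \<nu> where "\<nu> = \<rho>\<^sup>2 / 2"
  have \<nu>: "0 < \<nu>" "\<nu> < 1" "\<nu> / 4 \<le> \<rho>"
  proof -
    have "\<rho> * \<rho> \<le> 1 * \<rho>" using \<rho> by (intro mult_right_mono) auto
    moreover have "0 < \<rho> * \<rho>" using \<rho> by simp
    ultimately show "0 < \<nu>" "\<nu> < 1" "\<nu> / 4 \<le> \<rho>"
      unfolding \<nu>_def power2_eq_square using \<rho>(1,2) by linarith+
  qed
  define A where "A = 4 * (4 * K + \<nu> + 1) / e"
  have A: "0 < A" "A * (e / 4) = 4 * K + \<nu> + 1" using K e \<nu> by (auto simp: A_def)
  define \<sigma> where "\<sigma> = min ((\<nu> / (4 * A))\<^sup>2 / 2) (\<nu> / 4)"
  have \<sigma>: "0 < \<sigma>" "2 * \<sigma> \<le> (\<nu> / (4 * A))\<^sup>2" "\<sigma> \<le> \<nu> / 4" using A \<nu> by (auto simp: \<sigma>_def)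
  show thesis
  proof (rule that[of \<sigma> "\<nu> / 2"])
    fix \<theta> M t0 :: real and x y :: "real^'n"
    assume \<theta>: "0 < \<theta>" and M: "1 \<le> M" and t0: "s < t0"
      and outer: "\<And>t x y. t0 \<le> t \<Longrightarrow> t \<le> t0 + 1 \<Longrightarrow> norm x \<le> 1 \<Longrightarrow> norm y \<le> 1 \<Longrightarrow> u t x - u t y \<le> \<theta> * M"
      and xy: "norm x \<le> \<sigma>" "norm y \<le> \<sigma>"
    define \<Phi> where "\<Phi> = (\<lambda>t (x :: real^'n) (y :: real^'n). (M - \<nu> * (t - t0))
       + (A * ((norm (x - y))\<^sup>2) powr (1 / 4) + 1 / 2 * ((norm x)\<^sup>2 + (norm y)\<^sup>2)))"
    have "u (t0 + 1) x - u (t0 + 1) y \<le> \<theta> * \<Phi> (t0 + 1) x y"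
    proof (rule two_point_comparison[OF smooth pde t0 \<theta>, where ?t1.0 = "t0 + 1" and P = \<rho>])
      show "continuous_on ({t0..t0 + 1} \<times> cball 0 \<rho> \<times> cball 0 \<rho>) (\<lambda>(t, x, y). \<Phi> t x y)"
        unfolding \<Phi>_def case_prod_unfold by (intro continuous_intros continuous_on_powr') auto
      fix t x y
      assume *: "t0 \<le> t" "t \<le> t0 + 1" "norm x \<le> \<rho>" "norm y \<le> \<rho>" "\<theta> * \<Phi> t x y < u t x - u t y"
      have t: "0 \<le> t" using * s_nonneg t0 by auto
      have xy1: "norm x < 1" "norm y < 1" using * \<rho> by auto
      have "\<theta> * \<Phi> t x y < \<theta> * M"
        using *(5) outer[OF *(1,2), of x y] xy1 by simp
      then have "\<Phi> t x y < M" using \<theta> by simp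
      moreover have "0 \<le> A * ((norm (x - y))\<^sup>2) powr (1 / 4)" using A by simp
      ultimately have less: "1 / 2 * ((norm x)\<^sup>2 + (norm y)\<^sup>2) < \<nu> * (t - t0)"
        unfolding \<Phi>_def by linarith
      have "0 \<le> 1 / 2 * ((norm x)\<^sup>2 + (norm y)\<^sup>2)" by simp
      from this less have "0 < \<nu> * (t - t0)" by (rule le_less_trans)
      then have tt: "t0 < t" using \<nu> by (simp add: zero_less_mult_iff)
      have \<nu>t: "\<nu> * (t - t0) \<le> \<nu>" using \<nu> * by (simp add: mult_left_le)
      from less_le_trans[OF less this] have "(norm x)\<^sup>2 + (norm y)\<^sup>2 < \<rho>\<^sup>2"
        by (simp add: \<nu>_def)
      then have "(norm x)\<^sup>2 < \<rho>\<^sup>2" "(norm y)\<^sup>2 < \<rho>\<^sup>2"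
        using zero_le_power2[of "norm x"] zero_le_power2[of "norm y"] by linarith+
      then have "norm x < \<rho>" "norm y < \<rho>"
        using \<rho> power2_less_imp_less[of "norm x" \<rho>] power2_less_imp_less[of "norm y" \<rho>] by simp_all
      define z where "z = x - y"
      have z: "z \<noteq> 0"
      proof
        assume "z = 0"
        then have "\<Phi> t x y < 0" using *(5) \<theta> by (simp add: z_def mult_less_0_iff)
        moreover have "0 \<le> \<Phi> t x y"
        proof -
          have "0 \<le> M - \<nu> * (t - t0)" using M \<nu>t \<nu>(2) by linarith
          then show ?thesis unfolding \<Phi>_def using A by (intro add_nonneg_nonneg) auto
        qed
        ultimately show False by simp
      qed
      have nz: "norm z \<le> 2 * \<rho>" using norm_triangle_ineq4[of x y] * by (simp add: z_def)
      define r where "r = (norm z)\<^sup>2"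
      have r: "0 < r" "r \<le> 1"
        using z nz \<rho> by (auto simp: r_def power_le_one)
      define Z where "Z = r powr (- (3 / 4))"
      have Z: "0 < Z" "1 \<le> Z"
      proof -
        show "0 < Z" using r by (simp add: Z_def)
        have "r powr 0 \<le> Z" unfolding Z_def using r by (intro powr_mono') auto
        then show "1 \<le> Z" using r by simp
      qed
      define d1 where "d1 \<xi> \<zeta> = 2 * (z \<bullet> (\<xi> - \<zeta>))" for \<xi> \<zeta>
      define d2 where "d2 \<xi> \<zeta> = 2 * (norm (\<xi> - \<zeta>))\<^sup>2" for \<xi> \<zeta> :: "real^'n"
      have j: "jet2 (\<lambda>h. ((norm ((x + h *\<^sub>R \<xi>) - (y + h *\<^sub>R \<zeta>)))\<^sup>2) powr (1 / 4))
          (Z / 4 * d1 \<xi> \<zeta>) (- (3 / 16 * (Z / r)) * (d1 \<xi> \<zeta>)\<^sup>2 + Z / 4 * d2 \<xi> \<zeta>)" for \<xi> \<zeta>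
      proof -
        have eq: "(x + h *\<^sub>R \<xi>) - (y + h *\<^sub>R \<zeta>) = z + h *\<^sub>R (\<xi> - \<zeta>)" for h
          by (simp add: z_def algebra_simps)
        have 1: "((\<lambda>v. v powr (1 / 4)) has_real_derivative 1 / 4 * v powr (- (3 / 4))) (at v)" if "0 < v" for v :: real
          using has_real_derivative_powr[OF that, of "1 / 4"] by simp
        have "\<forall>\<^sub>F v in nhds r. v \<in> {0::real<..}"
          using r by (intro eventually_nhds_in_open) auto
        then have 2: "\<forall>\<^sub>F v in nhds r. ((\<lambda>v. v powr (1 / 4)) has_real_derivative 1 / 4 * v powr (- (3 / 4))) (at v)"
          by (rule eventually_mono) (use 1 in auto)
        have "r powr (- (7 / 4)) = Z / r"
          using powr_add[of r "- (3 / 4)" "- 1"] r by (simp add: Z_def powr_minus_divide)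
        then have 3: "((\<lambda>v. 1 / 4 * v powr (- (3 / 4))) has_real_derivative - (3 / 16 * (Z / r))) (at r)"
          using DERIV_cmult[OF has_real_derivative_powr[OF r(1), of "- (3 / 4)"], of "1 / 4"] by simp
        have "jet2 (\<lambda>h. (norm (z + h *\<^sub>R (\<xi> - \<zeta>)))\<^sup>2) (d1 \<xi> \<zeta>) (d2 \<xi> \<zeta>)"
          unfolding d1_def d2_def by (rule jet2_norm_square)
        from jet2_compose[OF this, of "\<lambda>v. v powr (1 / 4)" "\<lambda>v. 1 / 4 * v powr (- (3 / 4))" "- (3 / 16 * (Z / r))"] 2 3
        show ?thesis unfolding eq by (simp add: r_def[symmetric] Z_def)
      qed
      obtain ps where ps: "factors (Q t x) (map fst ps)" "factors (Q t y) (map snd ps)"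
        "(\<Sum>p\<leftarrow>ps. (norm (fst p - snd p))\<^sup>2) \<le> 2 * e + 3 * real CARD('n) * l"
        "(\<Sum>p\<leftarrow>ps. (z \<bullet> (fst p - snd p))\<^sup>2) \<ge> 2 * e * (norm z)\<^sup>2"
      proof (rule mirror_coupling[of "Q t x" "Q t y" e "l / n\<^sup>2" l z])
        show "\<bar>Q t x $ i $ j - Q t y $ i $ j\<bar> \<le> l / n\<^sup>2" for i j
          using \<rho>1(2)[OF t, of x y] xy1 nz \<rho> by (simp add: z_def)
      qed (use sym_Q[OF t] e(1) e(2)[OF t] l n z in \<open>auto simp: n_def\<close>)
      define S1 where "S1 = (\<Sum>p\<leftarrow>ps. (z \<bullet> (fst p - snd p))\<^sup>2)"
      define S2 where "S2 = (\<Sum>p\<leftarrow>ps. (norm (fst p - snd p))\<^sup>2)"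
      have S: "S2 \<le> 2 * e + e / 4" "2 * e * r \<le> S1"
        using ps(3,4) l(2) by (simp_all add: S1_def S2_def r_def n_def)
      define D1 where "D1 \<xi> \<zeta> = 0 + (A * (Z / 4 * d1 \<xi> \<zeta>) + 1 / 2 * (2 * (x \<bullet> \<xi>) + 2 * (y \<bullet> \<zeta>)))" for \<xi> \<zeta>
      define D2 where "D2 \<xi> \<zeta> = 0 + (A * (- (3 / 16 * (Z / r)) * (d1 \<xi> \<zeta>)\<^sup>2 + Z / 4 * d2 \<xi> \<zeta>)
         + 1 / 2 * (2 * (norm \<xi>)\<^sup>2 + 2 * (norm \<zeta>)\<^sup>2))" for \<xi> \<zeta>
      have "jet2 (\<lambda>h. \<Phi> t (x + h *\<^sub>R \<xi>) (y + h *\<^sub>R \<zeta>)) (D1 \<xi> \<zeta>) (D2 \<xi> \<zeta>)" for \<xi> \<zeta>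
        unfolding \<Phi>_def D1_def D2_def
        by (rule jet2_add[OF jet2_const jet2_add[OF jet2_cmult[OF j] jet2_cmult[OF jet2_add[OF jet2_norm_square jet2_norm_square]]]])
      moreover have "((\<lambda>t. \<Phi> t x y) has_real_derivative - \<nu>) (at t)"
        unfolding \<Phi>_def by (auto intro!: derivative_eq_intros)
      moreover have "(\<Sum>(\<xi>, \<zeta>)\<leftarrow>ps. D2 \<xi> \<zeta>) + D1 (b t x) (b t y) < - \<nu>"
      proof -
        have scal: "A * (- (3 / 16 * (Z / r)) * (2 * m)\<^sup>2 + Z / 4 * (2 * N)) = A * (- (3 / 4 * (Z / r)) * m\<^sup>2 + Z / 2 * N)" for m N
          by (simp add: power_mult_distrib mult_ac)
        have D2: "D2 \<xi> \<zeta> = A * (- (3 / 4 * (Z / r)) * (z \<bullet> (\<xi> - \<zeta>))\<^sup>2 + Z / 2 * (norm (\<xi> - \<zeta>))\<^sup>2)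
            + ((norm \<xi>)\<^sup>2 + (norm \<zeta>)\<^sup>2)" for \<xi> \<zeta>
          unfolding D2_def d1_def d2_def scal by simp
        have "(\<Sum>(\<xi>, \<zeta>)\<leftarrow>qs. D2 \<xi> \<zeta>) = A * (- (3 / 4 * (Z / r)) * (\<Sum>p\<leftarrow>qs. (z \<bullet> (fst p - snd p))\<^sup>2)
            + Z / 2 * (\<Sum>p\<leftarrow>qs. (norm (fst p - snd p))\<^sup>2))
            + ((\<Sum>p\<leftarrow>qs. (norm (fst p))\<^sup>2) + (\<Sum>p\<leftarrow>qs. (norm (snd p))\<^sup>2))" for qs
          unfolding case_prod_unfold D2 by (induction qs) (simp_all add: distrib_left right_diff_distrib)
        then have sum: "(\<Sum>(\<xi>, \<zeta>)\<leftarrow>ps. D2 \<xi> \<zeta>) = A * (- (3 / 4 * (Z / r)) * S1 + Z / 2 * S2) + (trace (Q t x) + trace (Q t y))"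
          unfolding S1_def S2_def factors_norm[OF ps(1), symmetric] factors_norm[OF ps(2), symmetric]
          by (simp add: o_def)
        have drift: "z \<bullet> (b t x - b t y) \<le> e / 4"
        proof -
          have "norm (b t x - b t y) \<le> 2 * K"
            using norm_triangle_ineq4[of "b t x" "b t y"] K(3)[OF t, of x] K(3)[OF t, of y] xy1 by simp
          then have "norm z * norm (b t x - b t y) \<le> (2 * \<rho>) * (2 * K)"
            using nz \<rho> by (intro mult_mono) auto
          then show ?thesis
            using norm_cauchy_schwarz[of z "b t x - b t y"] \<rho>(4) by linarith
        qed
        have inner: "x \<bullet> b t x \<le> K" "y \<bullet> b t y \<le> K"
          using norm_cauchy_schwarz[of x "b t x"] norm_cauchy_schwarz[of y "b t y"]
            mult_mono[of "norm x" 1 "norm (b t x)" K] mult_mono[of "norm y" 1 "norm (b t y)" K]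
            K(3)[OF t, of x] K(3)[OF t, of y] xy1 by simp_all
        have tr: "trace (Q t x) \<le> K" "trace (Q t y) \<le> K" using K(2)[OF t] xy1 by auto
        have "(Z / r) * (2 * e * r) \<le> (Z / r) * S1" using S Z r by (intro mult_left_mono) auto
        then have 1: "2 * (Z * e) \<le> (Z / r) * S1" using r by (simp add: mult_ac)
        have "Z * S2 \<le> Z * (9 / 4 * e)" using S Z by (intro mult_left_mono) auto
        then have 2: "Z * S2 \<le> 9 / 4 * (Z * e)" by (simp add: mult_ac)
        have 3: "Z * (z \<bullet> (b t x - b t y)) \<le> Z * (e / 4)" using drift Z by (intro mult_left_mono) auto
        have 4: "1 * e \<le> Z * e" using Z e by (intro mult_right_mono) auto
        have "- (3 / 4 * (Z / r)) * S1 + Z / 2 * S2 + Z / 2 * (z \<bullet> (b t x - b t y))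
          = - (3 / 4) * ((Z / r) * S1) + 1 / 2 * (Z * S2) + 1 / 2 * (Z * (z \<bullet> (b t x - b t y)))" by simp
        \<comment> \<open>The coefficients of \<open>Z * e\<close> add up to \<open>- 3/2 + 9/8 + 1/8 = - 1/4\<close>.\<close>
        also have "\<dots> \<le> - (3 / 4) * (2 * (Z * e)) + 1 / 2 * (9 / 4 * (Z * e)) + 1 / 2 * (Z * (e / 4))"
          by (intro add_mono mult_left_mono mult_left_mono_neg 1 2 3) auto
        also have "\<dots> \<le> - (e / 4)" using 4 by simp
        finally have "- (3 / 4 * (Z / r)) * S1 + Z / 2 * S2 + Z / 2 * (z \<bullet> (b t x - b t y)) \<le> - (e / 4)" .
        then have "A * (- (3 / 4 * (Z / r)) * S1 + Z / 2 * S2 + Z / 2 * (z \<bullet> (b t x - b t y))) \<le> A * (- (e / 4))"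
          using A by (intro mult_left_mono) auto
        also have "\<dots> = - (4 * K + \<nu> + 1)" unfolding mult_minus_right A(2) ..
        finally have main: "A * (- (3 / 4 * (Z / r)) * S1 + Z / 2 * S2 + Z / 2 * (z \<bullet> (b t x - b t y))) \<le> - (4 * K + \<nu> + 1)" .
        have "(\<Sum>(\<xi>, \<zeta>)\<leftarrow>ps. D2 \<xi> \<zeta>) + D1 (b t x) (b t y) =
          A * (- (3 / 4 * (Z / r)) * S1 + Z / 2 * S2 + Z / 2 * (z \<bullet> (b t x - b t y))) +
          (trace (Q t x) + trace (Q t y)) + (x \<bullet> b t x + y \<bullet> b t y)"
        proof -
          have "D1 (b t x) (b t y) = A * (Z / 2 * (z \<bullet> (b t x - b t y))) + (x \<bullet> b t x + y \<bullet> b t y)"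
            unfolding D1_def d1_def by simp
          then show ?thesis unfolding sum distrib_left[of A] by linarith
        qed
        with main tr inner show ?thesis by linarith
      qed
      ultimately have "strict_supersolution_at Q b \<Phi> t x y"
        unfolding strict_supersolution_at_def using ps(1,2) by blast
      with tt \<open>norm x < \<rho>\<close> \<open>norm y < \<rho>\<close>
      show "t0 < t \<and> norm x < \<rho> \<and> norm y < \<rho> \<and> strict_supersolution_at Q b \<Phi> t x y" by simp
    qed (use xy \<sigma> \<nu> in auto)
    also have "\<theta> * \<Phi> (t0 + 1) x y \<le> \<theta> * (M - \<nu> / 2)"
    proof (rule mult_left_mono)
      have "norm (x - y) \<le> 2 * \<sigma>" using norm_triangle_ineq4[of x y] xy by simp
      then have "(norm (x - y))\<^sup>2 \<le> ((\<nu> / (4 * A))\<^sup>2)\<^sup>2" using \<sigma> by (intro power_mono) auto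
      then have "((norm (x - y))\<^sup>2) powr (1 / 4) \<le> ((\<nu> / (4 * A)) ^ 4) powr (1 / 4)"
        by (intro powr_mono2) (auto simp: power_mult[symmetric])
      also have "\<dots> = \<nu> / (4 * A)"
      proof -
        have pos: "0 < \<nu> / (4 * A)" using A \<nu> by simp
        have "(\<nu> / (4 * A)) ^ 4 = (\<nu> / (4 * A)) powr 4"
          using powr_realpow[OF pos, of 4] by simp
        then have "((\<nu> / (4 * A)) ^ 4) powr (1 / 4) = (\<nu> / (4 * A)) powr (4 * (1 / 4))"
          by (simp only: powr_powr)
        also have "\<dots> = \<nu> / (4 * A)" using pos powr_one[of "\<nu> / (4 * A)"] by simp
        finally show ?thesis .
      qed
      finally have "A * ((norm (x - y))\<^sup>2) powr (1 / 4) \<le> A * (\<nu> / (4 * A))"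
        using A by (intro mult_left_mono) auto
      then have 1: "A * ((norm (x - y))\<^sup>2) powr (1 / 4) \<le> \<nu> / 4" using A by simp
      have "v\<^sup>2 \<le> \<nu> / 4" if "0 \<le> v" "v \<le> \<sigma>" for v
      proof -
        have "v * v \<le> \<sigma> * 1" using that \<sigma> \<nu> by (intro mult_mono) auto
        then show ?thesis using \<sigma> by (simp add: power2_eq_square)
      qed
      then have "(norm x)\<^sup>2 \<le> \<nu> / 4" "(norm y)\<^sup>2 \<le> \<nu> / 4" using xy by auto
      then have 2: "1 / 2 * ((norm x)\<^sup>2 + (norm y)\<^sup>2) \<le> \<nu> / 4" by simp
      have "\<Phi> (t0 + 1) x y \<le> (M - \<nu>) + (\<nu> / 4 + \<nu> / 4)"
        using add_left_mono[OF add_mono[OF 1 2], of "M - \<nu>"] by (simp add: \<Phi>_def)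
      then show "\<Phi> (t0 + 1) x y \<le> M - \<nu> / 2" by simp
    qed (use \<theta> in simp)
    finally show "u (t0 + 1) x - u (t0 + 1) y \<le> \<theta> * (M - \<nu> / 2)" .
  qed (use \<sigma> \<nu> in auto)
qed

text \<open>If a bound is better by \<open>\<delta>0\<close> near the origin, it becomes better by some \<open>\<delta>\<close> on every ball. With
\<open>\<psi> = |x|\<^sup>2 + |y|\<^sup>2\<close> the function \<open>exp (- k * \<psi>)\<close> is a strict subsolution away from the origin if
\<open>k\<close> is large, as in Hopf's lemma. Subtract \<open>\<delta>0 * (exp (- k * \<psi>) - 1 + \<nu> * (t - t0))\<close> from \<open>M\<close>: the
bracket is nonpositive initially, at most 1 on the inner ball, and still nonpositive for
\<open>\<psi> \<ge> (2 R)\<^sup>2\<close> at the final time \<open>t0 + \<tau>\<close>. But it is then positive for \<open>|x| \<le> R\<close> and \<open>|y| \<le> R\<close>,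
where \<open>\<psi> \<le> 2 R\<^sup>2 < (2 R)\<^sup>2\<close>; hence the factor 2 between the radii.\<close>

lemma contraction_spreads:
  assumes R: "0 < R" and \<sigma>: "0 < \<sigma>" and \<delta>0: "0 < \<delta>0"
  obtains \<tau> \<delta> where "0 < \<tau>" "0 < \<delta>"
    "\<And>\<theta> M t0 x y. 0 < \<theta> \<Longrightarrow> s < t0 \<Longrightarrow>
      (\<And>t x y. t0 \<le> t \<Longrightarrow> t \<le> t0 + \<tau> \<Longrightarrow> norm x \<le> 2 * R \<Longrightarrow> norm y \<le> 2 * R \<Longrightarrow> u t x - u t y \<le> \<theta> * M) \<Longrightarrow>
      (\<And>t x y. t0 \<le> t \<Longrightarrow> t \<le> t0 + \<tau> \<Longrightarrow> norm x \<le> \<sigma> \<Longrightarrow> norm y \<le> \<sigma> \<Longrightarrow> u t x - u t y \<le> \<theta> * (M - \<delta>0)) \<Longrightarrow>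
      norm x \<le> R \<Longrightarrow> norm y \<le> R \<Longrightarrow> u (t0 + \<tau>) x - u (t0 + \<tau>) y \<le> \<theta> * (M - \<delta>)"
proof -
  define P where "P = 2 * R"
  obtain e where e: "0 < e" "\<And>t x \<xi>. 0 \<le> t \<Longrightarrow> e * (norm \<xi>)\<^sup>2 \<le> (Q t x *v \<xi>) \<bullet> \<xi>"
    using uniformly_elliptic by blast
  obtain K where K: "0 < K" "\<And>t x. 0 \<le> t \<Longrightarrow> norm x < P + 1 \<Longrightarrow> trace (Q t x) \<le> K"
    "\<And>t x. 0 \<le> t \<Longrightarrow> norm x < P + 1 \<Longrightarrow> norm (b t x) \<le> K"
    using locally_bounded_coefficients[of "P + 1"] R by (auto simp: P_def)
  \<comment> \<open>The term of order \<open>k\<^sup>2\<close> exceeds the trace and drift terms of order \<open>k\<close> as soon as \<open>\<psi> \<ge> \<sigma>\<^sup>2\<close>.\<close>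
  define k where "k = (4 * K + 4 * P * K + 1) / (4 * e * \<sigma>\<^sup>2)"
  have k: "0 < k" using K e R \<sigma> by (auto simp: k_def P_def intro!: divide_pos_pos add_nonneg_pos)
  define \<nu> where "\<nu> = k * exp (- k * (2 * P\<^sup>2)) / 2"
  have \<nu>: "0 < \<nu>" using k by (simp add: \<nu>_def)
  define \<tau> where "\<tau> = (1 - exp (- k * P\<^sup>2)) / \<nu>"
  have \<tau>: "0 < \<tau>" using \<nu> k R by (simp add: \<tau>_def P_def)
  have \<nu>\<tau>: "\<nu> * \<tau> = 1 - exp (- k * P\<^sup>2)" using \<nu> by (simp add: \<tau>_def)
  define \<delta> where "\<delta> = \<delta>0 * (exp (- k * (2 * R\<^sup>2)) - exp (- k * P\<^sup>2))"
  have "0 < \<delta>" using \<delta>0 k R by (simp add: \<delta>_def P_def power2_eq_square)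
  show thesis
  proof (rule that[OF \<tau> \<open>0 < \<delta>\<close>])
    fix \<theta> M t0 :: real and x y :: "real^'n"
    assume \<theta>: "0 < \<theta>" and t0: "s < t0"
      and outer: "\<And>t x y. t0 \<le> t \<Longrightarrow> t \<le> t0 + \<tau> \<Longrightarrow> norm x \<le> 2 * R \<Longrightarrow> norm y \<le> 2 * R \<Longrightarrow> u t x - u t y \<le> \<theta> * M"
      and inner: "\<And>t x y. t0 \<le> t \<Longrightarrow> t \<le> t0 + \<tau> \<Longrightarrow> norm x \<le> \<sigma> \<Longrightarrow> norm y \<le> \<sigma> \<Longrightarrow> u t x - u t y \<le> \<theta> * (M - \<delta>0)"
      and xy: "norm x \<le> R" "norm y \<le> R"
    define \<psi> where "\<psi> = (\<lambda>(x :: real^'n) (y :: real^'n). (norm x)\<^sup>2 + (norm y)\<^sup>2)"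
    define \<Phi> where "\<Phi> = (\<lambda>t x y. (M - \<delta>0 * \<nu> * (t - t0) + \<delta>0) + (- \<delta>0) * exp ((- k) * \<psi> x y))"
    have "u (t0 + \<tau>) x - u (t0 + \<tau>) y \<le> \<theta> * \<Phi> (t0 + \<tau>) x y"
    proof (rule two_point_comparison[OF smooth pde t0 \<theta>, where ?t1.0 = "t0 + \<tau>" and P = P])
      show "continuous_on ({t0..t0 + \<tau>} \<times> cball 0 P \<times> cball 0 P) (\<lambda>(t, x, y). \<Phi> t x y)"
        unfolding \<Phi>_def \<psi>_def case_prod_unfold by (intro continuous_intros)
      fix t x y
      assume *: "t0 \<le> t" "t \<le> t0 + \<tau>" "norm x \<le> P" "norm y \<le> P" "\<theta> * \<Phi> t x y < u t x - u t y"
      have t: "0 \<le> t" using * s_nonneg t0 by auto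
      have \<psi>0: "0 \<le> \<psi> x y" by (simp add: \<psi>_def)
      have "\<theta> * \<Phi> t x y < \<theta> * M"
        using *(5) outer[OF *(1,2), of x y] *(3,4) by (simp add: P_def)
      then have M: "\<Phi> t x y < M" using \<theta> by simp
      then have "\<delta>0 * (1 - exp (- k * \<psi> x y)) < \<delta>0 * (\<nu> * (t - t0))"
        by (simp add: \<Phi>_def algebra_simps)
      then have less: "1 - exp (- k * \<psi> x y) < \<nu> * (t - t0)"
        using \<delta>0 by simp
      have "0 \<le> 1 - exp (- k * \<psi> x y)" using k \<psi>0 by simp
      with less have "t0 < t" using \<nu> by (smt (verit) zero_less_mult_pos)
      have "\<nu> * (t - t0) \<le> \<nu> * \<tau>" using * \<nu> by (intro mult_left_mono) auto
      with less \<nu>\<tau> have "exp (- k * P\<^sup>2) < exp (- k * \<psi> x y)" by linarith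
      then have \<psi>P: "\<psi> x y < P\<^sup>2" using k by simp
      then have "(norm x)\<^sup>2 < P\<^sup>2" "(norm y)\<^sup>2 < P\<^sup>2"
        unfolding \<psi>_def using zero_le_power2[of "norm x"] zero_le_power2[of "norm y"] by linarith+
      then have "norm x < P" "norm y < P"
        using R power2_less_imp_less[of "norm x" P] power2_less_imp_less[of "norm y" P] by (simp_all add: P_def)
      have "\<not> (norm x \<le> \<sigma> \<and> norm y \<le> \<sigma>)"
      proof
        assume "norm x \<le> \<sigma> \<and> norm y \<le> \<sigma>"
        then have "\<theta> * \<Phi> t x y < \<theta> * (M - \<delta>0)"
          using *(5) inner[OF *(1,2), of x y] by linarith
        then have "\<Phi> t x y < M - \<delta>0" using \<theta> by simp
        then have "\<delta>0 * (2 - exp (- k * \<psi> x y)) < \<delta>0 * (\<nu> * (t - t0))"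
          by (simp add: \<Phi>_def algebra_simps)
        then have "2 - exp (- k * \<psi> x y) < \<nu> * (t - t0)"
          using \<delta>0 by simp
        moreover have "exp (- k * \<psi> x y) \<le> 1" using k \<psi>0 by simp
        ultimately show False using \<open>\<nu> * (t - t0) \<le> \<nu> * \<tau>\<close> \<nu>\<tau> by (smt (verit) exp_gt_zero)
      qed
      then have "\<sigma>\<^sup>2 \<le> \<psi> x y"
        using \<sigma> by (auto simp: \<psi>_def not_le intro: add_increasing add_increasing2 power_mono)
      have "strict_supersolution_at Q b \<Phi> t x y"
      proof -
        obtain vs where vs: "factors (Q t x) vs" using Q_factors[OF t] by blast
        obtain ws where ws: "factors (Q t y) ws" using Q_factors[OF t] by blast
        define X where "X = exp ((- k) * \<psi> x y)"
        define l where "l \<xi> \<zeta> = 2 * (x \<bullet> \<xi>) + 2 * (y \<bullet> \<zeta>)" for \<xi> \<zeta>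
        define q where "q \<xi> \<zeta> = 2 * (norm \<xi>)\<^sup>2 + 2 * (norm \<zeta>)\<^sup>2" for \<xi> \<zeta> :: "real^'n"
        have X: "exp (- k * (2 * P\<^sup>2)) \<le> X"
        proof -
          have "\<psi> x y \<le> 2 * P\<^sup>2" using \<psi>P zero_le_power2[of P] by linarith
          then show ?thesis using k by (simp add: X_def)
        qed
        have X0: "0 < X" by (simp add: X_def)
        have j: "jet2 (\<lambda>h. exp ((- k) * \<psi> (x + h *\<^sub>R \<xi>) (y + h *\<^sub>R \<zeta>))) (X * ((- k) * l \<xi> \<zeta>))
           (X * ((- k) * l \<xi> \<zeta>)\<^sup>2 + X * ((- k) * q \<xi> \<zeta>))" for \<xi> \<zeta>
        proof -
          have "jet2 (\<lambda>h. (- k) * \<psi> (x + h *\<^sub>R \<xi>) (y + h *\<^sub>R \<zeta>)) ((- k) * l \<xi> \<zeta>) ((- k) * q \<xi> \<zeta>)"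
            unfolding \<psi>_def l_def q_def by (intro jet2_cmult jet2_add jet2_norm_square)
          from jet2_compose[OF this, of exp exp X] show ?thesis
            by (simp add: X_def DERIV_exp)
        qed
        show ?thesis
        proof (rule strict_supersolution_independentI[where Q = Q and t = t and x = x and y = y and
            ?D1.0 = "\<lambda>\<xi> \<zeta>. 0 + (- \<delta>0) * (X * ((- k) * l \<xi> \<zeta>))" and
            ?D2.0 = "\<lambda>\<xi> \<zeta>. 0 + (- \<delta>0) * (X * ((- k) * l \<xi> \<zeta>)\<^sup>2 + X * ((- k) * q \<xi> \<zeta>))", OF vs ws])
          show "jet2 (\<lambda>h. \<Phi> t (x + h *\<^sub>R \<xi>) (y + h *\<^sub>R \<zeta>)) (0 + (- \<delta>0) * (X * ((- k) * l \<xi> \<zeta>)))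
             (0 + (- \<delta>0) * (X * ((- k) * l \<xi> \<zeta>)\<^sup>2 + X * ((- k) * q \<xi> \<zeta>)))" for \<xi> \<zeta>
            unfolding \<Phi>_def by (rule jet2_add[OF jet2_const jet2_cmult[OF j]])
          show "((\<lambda>t. \<Phi> t x y) has_real_derivative (- \<delta>0 * \<nu>)) (at t)"
            unfolding \<Phi>_def by (auto intro!: derivative_eq_intros)
          have 1: "(\<Sum>v\<leftarrow>vs. (l v 0)\<^sup>2) = 4 * ((Q t x *v x) \<bullet> x)" "(\<Sum>v\<leftarrow>ws. (l 0 v)\<^sup>2) = 4 * ((Q t y *v y) \<bullet> y)"
            by (simp_all add: l_def power_mult_distrib sum_list_const_mult factors_inner[OF vs] factors_inner[OF ws])
          have 2: "(\<Sum>v\<leftarrow>vs. q v 0) = 2 * trace (Q t x)" "(\<Sum>v\<leftarrow>ws. q 0 v) = 2 * trace (Q t y)"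
            by (simp_all add: q_def sum_list_const_mult factors_norm[OF vs] factors_norm[OF ws])
          have "x \<bullet> b t x \<le> P * K"
            using norm_cauchy_schwarz[of x "b t x"] mult_mono[OF *(3) K(3)[OF t, of x]] *(3) R by (simp add: P_def)
          moreover have "y \<bullet> b t y \<le> P * K"
            using norm_cauchy_schwarz[of y "b t y"] mult_mono[OF *(4) K(3)[OF t, of y]] *(4) R by (simp add: P_def)
          ultimately have 3: "l (b t x) (b t y) \<le> 4 * P * K" by (simp add: l_def)
          have 4: "trace (Q t x) \<le> K" "trace (Q t y) \<le> K" using K(2)[OF t] *(3,4) by auto
          have "4 * K + 4 * P * K + 1 = k * (4 * e * \<sigma>\<^sup>2)" using e \<sigma> by (simp add: k_def)
          also have "\<dots> \<le> k * (4 * e * \<psi> x y)"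
            using k e \<open>\<sigma>\<^sup>2 \<le> \<psi> x y\<close> by (intro mult_left_mono) auto
          also have "\<dots> \<le> k * (4 * ((Q t x *v x) \<bullet> x) + 4 * ((Q t y *v y) \<bullet> y))"
            using k e(2)[OF t, of x x] e(2)[OF t, of y y] by (intro mult_left_mono) (auto simp: \<psi>_def algebra_simps)
          finally have "1 \<le> k * (4 * ((Q t x *v x) \<bullet> x) + 4 * ((Q t y *v y) \<bullet> y)) - (2 * trace (Q t x) + 2 * trace (Q t y)) - l (b t x) (b t y)"
            using 3 4 by linarith
          then have "(X * k) * 1 \<le> (X * k) * (k * (4 * ((Q t x *v x) \<bullet> x) + 4 * ((Q t y *v y) \<bullet> y)) - (2 * trace (Q t x) + 2 * trace (Q t y)) - l (b t x) (b t y))"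
            using X0 k by (intro mult_left_mono) auto
          moreover have "\<nu> < X * k"
          proof -
            have "2 * \<nu> = k * exp (- k * (2 * P\<^sup>2))" by (simp add: \<nu>_def)
            also have "\<dots> \<le> k * X" using X k by (intro mult_left_mono) auto
            finally show ?thesis using \<nu> by (simp add: mult.commute)
          qed
          ultimately have "\<delta>0 * \<nu> < \<delta>0 * ((X * k) * (k * (4 * ((Q t x *v x) \<bullet> x) + 4 * ((Q t y *v y) \<bullet> y)) - (2 * trace (Q t x) + 2 * trace (Q t y)) - l (b t x) (b t y)))"
            using \<delta>0 by (intro mult_strict_left_mono) linarith+
          moreover have "(\<Sum>v\<leftarrow>vs. 0 + (- \<delta>0) * (X * ((- k) * l v 0)\<^sup>2 + X * ((- k) * q v 0)))
             = - \<delta>0 * (X * (k\<^sup>2 * (\<Sum>v\<leftarrow>vs. (l v 0)\<^sup>2) - k * (\<Sum>v\<leftarrow>vs. q v 0)))"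
            unfolding sum_list_const_mult[symmetric] sum_list_subtractf[symmetric]
            by (simp add: power_mult_distrib algebra_simps)
          moreover have "(\<Sum>v\<leftarrow>ws. 0 + (- \<delta>0) * (X * ((- k) * l 0 v)\<^sup>2 + X * ((- k) * q 0 v)))
             = - \<delta>0 * (X * (k\<^sup>2 * (\<Sum>v\<leftarrow>ws. (l 0 v)\<^sup>2) - k * (\<Sum>v\<leftarrow>ws. q 0 v)))"
            unfolding sum_list_const_mult[symmetric] sum_list_subtractf[symmetric]
            by (simp add: power_mult_distrib algebra_simps)
          ultimately show "(\<Sum>v\<leftarrow>vs. 0 + (- \<delta>0) * (X * ((- k) * l v 0)\<^sup>2 + X * ((- k) * q v 0)))
             + (\<Sum>w\<leftarrow>ws. 0 + (- \<delta>0) * (X * ((- k) * l 0 w)\<^sup>2 + X * ((- k) * q 0 w)))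
             + (0 + (- \<delta>0) * (X * ((- k) * l (b t x) (b t y)))) < - \<delta>0 * \<nu>"
            unfolding 1 2 by (simp add: algebra_simps power2_eq_square)
        qed
      qed
      with \<open>t0 < t\<close> \<open>norm x < P\<close> \<open>norm y < P\<close>
      show "t0 < t \<and> norm x < P \<and> norm y < P \<and> strict_supersolution_at Q b \<Phi> t x y" by simp
    qed (use \<tau> xy R in \<open>auto simp: P_def\<close>)
    also have "\<theta> * \<Phi> (t0 + \<tau>) x y \<le> \<theta> * (M - \<delta>)"
    proof (rule mult_left_mono)
      have "\<psi> x y \<le> R\<^sup>2 + R\<^sup>2" unfolding \<psi>_def using xy by (intro add_mono power_mono) auto
      then have "exp (- k * (2 * R\<^sup>2)) \<le> exp (- k * \<psi> x y)" using k by simp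
      then have "\<delta> \<le> \<delta>0 * (exp (- k * \<psi> x y) - exp (- k * P\<^sup>2))"
        unfolding \<delta>_def using \<delta>0 by (intro mult_left_mono) auto
      moreover have "\<Phi> (t0 + \<tau>) x y = M - \<delta>0 * (exp (- k * \<psi> x y) - exp (- k * P\<^sup>2))"
      proof -
        have "\<delta>0 * \<nu> * \<tau> = \<delta>0 * (1 - exp (- k * P\<^sup>2))" using \<nu>\<tau> by (simp add: mult.assoc)
        then show ?thesis by (simp add: \<Phi>_def algebra_simps)
      qed
      ultimately show "\<Phi> (t0 + \<tau>) x y \<le> M - \<delta>" by linarith
    qed (use \<theta> in simp)
    finally show "u (t0 + \<tau>) x - u (t0 + \<tau>) y \<le> \<theta> * (M - \<delta>)" .
  qed
qed


section \<open>Decay of the oscillation\<close>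

text \<open>The improvement near the diagonal needs one unit of time and is available at every later time, as the
outer bound may be used on the unit interval before that time. This supplies the inner bound from which the
improvement spreads.\<close>

lemma contraction_on_balls:
  assumes R: "1 \<le> R"
  obtains \<tau> \<delta> where "1 \<le> \<tau>" "0 < \<delta>"
    "\<And>\<theta> M t0 x y. 0 < \<theta> \<Longrightarrow> 1 \<le> M \<Longrightarrow> s < t0 \<Longrightarrow>
      (\<And>t x y. t0 \<le> t \<Longrightarrow> t \<le> t0 + \<tau> \<Longrightarrow> norm x \<le> 2 * R \<Longrightarrow> norm y \<le> 2 * R \<Longrightarrow> u t x - u t y \<le> \<theta> * M) \<Longrightarrow>
      norm x \<le> R \<Longrightarrow> norm y \<le> R \<Longrightarrow> u (t0 + \<tau>) x - u (t0 + \<tau>) y \<le> \<theta> * (M - \<delta>)"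
proof -
  obtain \<sigma> \<delta>0 where near: "0 < \<sigma>" "0 < \<delta>0"
    "\<And>\<theta> M t0 x y. 0 < \<theta> \<Longrightarrow> 1 \<le> M \<Longrightarrow> s < t0 \<Longrightarrow>
      (\<And>t x y. t0 \<le> t \<Longrightarrow> t \<le> t0 + 1 \<Longrightarrow> norm x \<le> 1 \<Longrightarrow> norm y \<le> 1 \<Longrightarrow> u t x - u t y \<le> \<theta> * M) \<Longrightarrow>
      norm x \<le> \<sigma> \<Longrightarrow> norm y \<le> \<sigma> \<Longrightarrow> u (t0 + 1) x - u (t0 + 1) y \<le> \<theta> * (M - \<delta>0)"
    by (fact contraction_near_diagonal)
  have "0 < R" using R by simp
  obtain \<tau> \<delta> where spread: "0 < \<tau>" "0 < \<delta>"
    "\<And>\<theta> M t0 x y. 0 < \<theta> \<Longrightarrow> s < t0 \<Longrightarrow>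
      (\<And>t x y. t0 \<le> t \<Longrightarrow> t \<le> t0 + \<tau> \<Longrightarrow> norm x \<le> 2 * R \<Longrightarrow> norm y \<le> 2 * R \<Longrightarrow> u t x - u t y \<le> \<theta> * M) \<Longrightarrow>
      (\<And>t x y. t0 \<le> t \<Longrightarrow> t \<le> t0 + \<tau> \<Longrightarrow> norm x \<le> \<sigma> \<Longrightarrow> norm y \<le> \<sigma> \<Longrightarrow> u t x - u t y \<le> \<theta> * (M - \<delta>0)) \<Longrightarrow>
      norm x \<le> R \<Longrightarrow> norm y \<le> R \<Longrightarrow> u (t0 + \<tau>) x - u (t0 + \<tau>) y \<le> \<theta> * (M - \<delta>)"
    by (fact contraction_spreads[OF \<open>0 < R\<close> near(1,2)])
  show thesis
  proof (rule that[of "1 + \<tau>" \<delta>])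
    fix \<theta> M t0 :: real and x y :: "real^'n"
    assume *: "0 < \<theta>" "1 \<le> M" "s < t0"
      and outer: "\<And>t x y. t0 \<le> t \<Longrightarrow> t \<le> t0 + (1 + \<tau>) \<Longrightarrow> norm x \<le> 2 * R \<Longrightarrow> norm y \<le> 2 * R \<Longrightarrow> u t x - u t y \<le> \<theta> * M"
      and xy: "norm x \<le> R" "norm y \<le> R"
    have "u ((t0 + 1) + \<tau>) x - u ((t0 + 1) + \<tau>) y \<le> \<theta> * (M - \<delta>)"
    proof (rule spread(3)[OF *(1) _ _ _ xy])
      show "u t x - u t y \<le> \<theta> * M" if "t0 + 1 \<le> t" "t \<le> t0 + 1 + \<tau>" "norm x \<le> 2 * R" "norm y \<le> 2 * R" for t x y
        using that by (intro outer) auto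
      show "u t x - u t y \<le> \<theta> * (M - \<delta>0)"
        if t: "t0 + 1 \<le> t" "t \<le> t0 + 1 + \<tau>" and "norm x \<le> \<sigma>" "norm y \<le> \<sigma>" for t x y
      proof -
        have "u ((t - 1) + 1) x - u ((t - 1) + 1) y \<le> \<theta> * (M - \<delta>0)"
        proof (rule near(3)[OF *(1,2)])
          show "s < t - 1" using t * by simp
          show "u r x - u r y \<le> \<theta> * M" if "t - 1 \<le> r" "r \<le> t - 1 + 1" "norm x \<le> 1" "norm y \<le> 1" for r x y
            using that t R by (intro outer) auto
        qed (use that in auto)
        then show ?thesis by simp
      qed
    qed (use * in auto)
    then show "u (t0 + (1 + \<tau>)) x - u (t0 + (1 + \<tau>)) y \<le> \<theta> * (M - \<delta>)" by (simp add: add_ac)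
  qed (use spread in auto)
qed

lemma V_max_on_ball:
  assumes "0 \<le> R"
  obtains z where "\<And>x. norm x \<le> R \<Longrightarrow> V x \<le> V z"
proof -
  obtain z where "\<forall>y\<in>cball 0 R. V y \<le> V z"
    using continuous_attains_sup[of "cball 0 R" V, OF compact_cball _ V_continuous] assms by auto
  then show thesis using that[of z] by simp
qed

text \<open>Where \<open>V x + V y \<ge> W\<close>, the exponential decay of the Lyapunov bound outweighs its additive constant.
Where \<open>V x + V y < W\<close>, both points lie in a fixed ball; there \<open>\<beta>\<close> is taken so small that the Lyapunov
bound is at most \<open>1 + \<delta> / 2\<close> on the double ball during the whole period, and the gain \<open>\<delta>\<close> leaves
\<open>1 - \<delta> / 2\<close>. The order of the choices matters: \<open>W\<close> must not depend on the length \<open>\<tau>\<close> of the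
period, and it does not because \<open>\<tau> \<ge> 1\<close>.\<close>

lemma weighted_contraction:
  obtains \<beta> \<tau> q where "0 < \<beta>" "0 < \<tau>" "0 < q" "q < 1"
    "\<And>\<theta> t0 x y. 0 < \<theta> \<Longrightarrow> s < t0 \<Longrightarrow> (\<And>x y. u t0 x - u t0 y \<le> \<theta> * (1 + \<beta> * (V x + V y))) \<Longrightarrow>
       u (t0 + \<tau>) x - u (t0 + \<tau>) y \<le> (q * \<theta>) * (1 + \<beta> * (V x + V y))"
proof -
  define k where "k = (2 * a + 1) / \<kappa>"
  have k: "0 < k" using lyapunov_consts by (simp add: k_def)
  define g where "g = exp (- \<kappa>)"
  have g: "0 < g" "g < 1" using lyapunov_consts by (simp_all add: g_def)
  define W where "W = 2 * k / (1 - g)"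
  have W: "0 < W" "(1 - g) * W = 2 * k" using k g by (simp_all add: W_def)
  obtain R0 where R0: "\<And>x. R0 \<le> norm x \<Longrightarrow> W \<le> V x"
    using V_at_infinity unfolding filterlim_at_top eventually_at_infinity by meson
  define R where "R = max 1 R0"
  have R: "1 \<le> R" by (simp add: R_def)
  obtain \<tau> \<delta> where c: "1 \<le> \<tau>" "0 < \<delta>"
    "\<And>\<theta> M t0 x y. 0 < \<theta> \<Longrightarrow> 1 \<le> M \<Longrightarrow> s < t0 \<Longrightarrow>
      (\<And>t x y. t0 \<le> t \<Longrightarrow> t \<le> t0 + \<tau> \<Longrightarrow> norm x \<le> 2 * R \<Longrightarrow> norm y \<le> 2 * R \<Longrightarrow> u t x - u t y \<le> \<theta> * M) \<Longrightarrow>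
      norm x \<le> R \<Longrightarrow> norm y \<le> R \<Longrightarrow> u (t0 + \<tau>) x - u (t0 + \<tau>) y \<le> \<theta> * (M - \<delta>)"
    by (fact contraction_on_balls[OF R])
  obtain z where z: "\<And>x. norm x \<le> 2 * R \<Longrightarrow> V x \<le> V z"
    using V_max_on_ball[of "2 * R"] R by auto
  define B where "B = V z"
  have B: "0 < B" using V_pos by (simp add: B_def)
  define \<beta> where "\<beta> = \<delta> / (2 * (2 * B + k))"
  have \<beta>: "0 < \<beta>" "\<beta> * (2 * B + k) = \<delta> / 2"
  proof -
    have *: "\<delta> / (2 * X) * X = \<delta> / 2" if "0 < X" for X :: real using that by simp
    have pos: "0 < 2 * B + k" using B k by simp
    then show "0 < \<beta>" unfolding \<beta>_def using c(2) by simp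
    show "\<beta> * (2 * B + k) = \<delta> / 2" unfolding \<beta>_def by (rule *[OF pos])
  qed
  define d where "d = min (1 / 2) (min (\<delta> / 2) (min ((1 - g) / 4) (\<beta> * (1 - g) * W / 4)))"
  have d: "0 < d" "d \<le> 1 / 2" "d \<le> \<delta> / 2" "d \<le> (1 - g) / 4" "d \<le> \<beta> * (1 - g) * W / 4"
  proof -
    show "0 < d" using c(2) g \<beta>(1) W(1) by (simp add: d_def)
  qed (simp_all only: d_def min_le_iff_disj order_refl simp_thms)
  show thesis
  proof (rule that[of \<beta> \<tau> "1 - d"])
    fix \<theta> t0 :: real and x y :: "real^'n"
    assume \<theta>: "0 < \<theta>" and t0: "s < t0"
      and init: "\<And>x y. u t0 x - u t0 y \<le> \<theta> * (1 + \<beta> * (V x + V y))"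
    define E where "E t = exp (- \<kappa> * (t - t0))" for t
    have E: "0 < E t" for t by (simp add: E_def)
    have E1: "E t \<le> 1" if "t0 \<le> t" for t using lyapunov_consts that by (simp add: E_def)
    have lyap: "u t x - u t y \<le> \<theta> * (1 + \<beta> * (E t * (V x + V y) + k))" if "t0 \<le> t" for t x y
    proof -
      have "u t x - u t y \<le> \<theta> * (1 + \<beta> * (E t * (V x + V y) + k * (1 - E t)))"
        using lyapunov_bound[OF \<theta> \<beta>(1) t0 that init, of x y] by (simp add: E_def k_def)
      also have "\<dots> \<le> \<theta> * (1 + \<beta> * (E t * (V x + V y) + k * 1))"
        using \<theta> \<beta> k E[of t] by (intro mult_left_mono add_left_mono) auto
      finally show ?thesis by simp
    qed
    have w0: "0 \<le> V x + V y" using V_pos[of x] V_pos[of y] by simp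
    show "u (t0 + \<tau>) x - u (t0 + \<tau>) y \<le> ((1 - d) * \<theta>) * (1 + \<beta> * (V x + V y))"
    proof (cases "W \<le> V x + V y")
      case True
      have "E (t0 + \<tau>) \<le> g" using c(1) lyapunov_consts by (simp add: E_def g_def)
      then have "E (t0 + \<tau>) * (V x + V y) \<le> g * (V x + V y)" using w0 by (rule mult_right_mono)
      then have "\<theta> * (1 + \<beta> * (E (t0 + \<tau>) * (V x + V y) + k)) \<le> \<theta> * (1 + \<beta> * (g * (V x + V y) + k))"
        using \<theta> \<beta> by (intro mult_left_mono add_left_mono add_right_mono) auto
      also have "\<dots> \<le> \<theta> * ((1 - d) * (1 + \<beta> * (V x + V y)))"
      proof (rule mult_left_mono)
        have "2 * k \<le> (1 - g) * (V x + V y)"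
          unfolding W(2)[symmetric] using True g by (intro mult_left_mono) auto
        then have "k \<le> (1 - g) * (V x + V y) / 2" by simp
        then have k': "\<beta> * k \<le> \<beta> * ((1 - g) * (V x + V y) / 2)"
          using \<beta>(1) by (intro mult_left_mono) auto
        define X where "X = \<beta> * ((1 - g) * (V x + V y))"
        have "\<beta> * (1 - g) * W \<le> \<beta> * (1 - g) * (V x + V y)" using True \<beta>(1) g by (intro mult_left_mono) auto
        then have "d \<le> X / 4" using d(5) by (simp add: X_def mult_ac)
        moreover have "d * (\<beta> * (V x + V y)) \<le> (1 - g) / 4 * (\<beta> * (V x + V y))"
          using d(4) \<beta>(1) w0 by (intro mult_right_mono) auto
        then have "d * (\<beta> * (V x + V y)) \<le> X / 4" by (simp add: X_def mult_ac)
        ultimately have "d + d * (\<beta> * (V x + V y)) \<le> X - \<beta> * k"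
          using k' by (simp add: X_def)
        then show "1 + \<beta> * (g * (V x + V y) + k) \<le> (1 - d) * (1 + \<beta> * (V x + V y))"
          by (simp add: X_def algebra_simps)
      qed (use \<theta> in simp)
      finally show ?thesis using lyap[of "t0 + \<tau>" x y] c(1) by (simp add: mult_ac)
    next
      case False
      then have "V x < W" "V y < W" using V_pos[of x] V_pos[of y] by linarith+
      then have xy: "norm x \<le> R" "norm y \<le> R"
        using R0[of x] R0[of y] unfolding R_def by (meson le_max_iff_disj linear not_le)+
      have "u (t0 + \<tau>) x - u (t0 + \<tau>) y \<le> \<theta> * ((1 + \<delta> / 2) - \<delta>)"
      proof (rule c(3)[OF \<theta> _ t0 _ xy])
        fix t :: real and x y :: "real^'n" assume *: "t0 \<le> t" "t \<le> t0 + \<tau>" "norm x \<le> 2 * R" "norm y \<le> 2 * R"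
        have "E t * (V x + V y) \<le> 1 * (B + B)"
          using E1[OF *(1)] z[OF *(3)] z[OF *(4)] V_pos[of x] V_pos[of y]
          unfolding B_def by (intro mult_mono) auto
        then have "\<beta> * (E t * (V x + V y) + k) \<le> \<beta> * (2 * B + k)"
          using \<beta> by (intro mult_left_mono) auto
        then have "\<theta> * (1 + \<beta> * (E t * (V x + V y) + k)) \<le> \<theta> * (1 + \<delta> / 2)"
          unfolding \<beta>(2) using \<theta> by (intro mult_left_mono) auto
        with lyap[OF *(1), of x y] show "u t x - u t y \<le> \<theta> * (1 + \<delta> / 2)" by linarith
      qed (use c in auto)
      also have "\<dots> \<le> \<theta> * (1 - d)" using d \<theta> by (intro mult_left_mono) auto
      also have "\<dots> = ((1 - d) * \<theta>) * 1" by simp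
      also have "\<dots> \<le> ((1 - d) * \<theta>) * (1 + \<beta> * (V x + V y))"
        using \<theta> d \<beta> w0 by (intro mult_left_mono) auto
      finally show ?thesis .
    qed
  qed (use \<beta> c d in auto)
qed

text \<open>A given time is reached by as many periods as fit in between, started at some time in
\<open>{s + 1..< s + 1 + \<tau>}\<close>. The start is kept away from \<open>s\<close>, where \<open>u\<close> need not be
differentiable.\<close>

lemma oscillation_decay:
  obtains \<beta> g where "0 < \<beta>" "(g \<longlongrightarrow> 0) at_top"
    "\<And>t x y. s + 1 \<le> t \<Longrightarrow> \<bar>u t x - u t y\<bar> \<le> g t * (1 + \<beta> * (V x + V y))"
proof -
  obtain \<beta> \<tau> q where w: "0 < \<beta>" "0 < \<tau>" "0 < q" "q < 1"
    "\<And>\<theta> t0 x y. 0 < \<theta> \<Longrightarrow> s < t0 \<Longrightarrow> (\<And>x y. u t0 x - u t0 y \<le> \<theta> * (1 + \<beta> * (V x + V y))) \<Longrightarrow>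
       u (t0 + \<tau>) x - u (t0 + \<tau>) y \<le> (q * \<theta>) * (1 + \<beta> * (V x + V y))"
    by (fact weighted_contraction)
  have U: "0 \<le> U" using bound[of s undefined] by simp
  define C where "C = 2 * U + 1"
  have iter: "u (t0 + real n * \<tau>) x - u (t0 + real n * \<tau>) y \<le> (q ^ n * C) * (1 + \<beta> * (V x + V y))" if t0: "s < t0" for n t0 x y
  proof (induction n arbitrary: x y)
    case 0
    have "u t0 x - u t0 y \<le> C * 1"
      using bound[of t0 x] bound[of t0 y] t0 by (simp add: C_def)
    also have "\<dots> \<le> C * (1 + \<beta> * (V x + V y))"
      using U w V_pos[of x] V_pos[of y] by (intro mult_left_mono) (auto simp: C_def)
    finally show ?case by simp
  next
    case (Suc n)
    have "u ((t0 + real n * \<tau>) + \<tau>) x - u ((t0 + real n * \<tau>) + \<tau>) y \<le> (q * (q ^ n * C)) * (1 + \<beta> * (V x + V y))"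
    proof (rule w(5)[OF _ _ Suc.IH])
      show "s < t0 + real n * \<tau>" using t0 mult_nonneg_nonneg[OF of_nat_0_le_iff less_imp_le[OF w(2)], of n] by linarith
    qed (use U w(3) in \<open>auto simp: C_def\<close>)
    then show ?case by (simp add: algebra_simps)
  qed
  define N where "N t = nat \<lfloor>(t - (s + 1)) / \<tau>\<rfloor>" for t
  define g where "g t = q ^ N t * C" for t
  have one: "u t x - u t y \<le> g t * (1 + \<beta> * (V x + V y))" if t: "s + 1 \<le> t" for t x y
  proof -
    have "real (N t) = of_int \<lfloor>(t - (s + 1)) / \<tau>\<rfloor>"
      using t w(2) by (simp add: N_def)
    then have "real (N t) \<le> (t - (s + 1)) / \<tau>" by linarith
    then have "real (N t) * \<tau> \<le> t - (s + 1)" using w(2) by (simp add: field_simps)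
    then have "s < t - real (N t) * \<tau>" by simp
    from iter[OF this, of "N t" x y] show ?thesis by (simp add: g_def)
  qed
  show thesis
  proof (rule that[OF w(1)])
    have "filterlim N at_top at_top"
    proof -
      have "filterlim (\<lambda>t. (1 / \<tau>) * (- (s + 1) + t)) at_top at_top"
        by (rule filterlim_tendsto_pos_mult_at_top[OF tendsto_const _ filterlim_tendsto_add_at_top[OF tendsto_const filterlim_ident]])
          (use w(2) in simp)
      then have "filterlim (\<lambda>t. (t - (s + 1)) / \<tau>) at_top at_top"
        by (simp add: algebra_simps diff_divide_distrib)
      then show ?thesis
        unfolding N_def
        by (intro filterlim_compose[OF filterlim_nat_sequentially] filterlim_compose[OF filterlim_floor_sequentially])
    qed
    then have "((\<lambda>t. q ^ N t) \<longlongrightarrow> 0) at_top"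
      using w by (intro filterlim_compose[OF LIMSEQ_realpow_zero]) auto
    then show "(g \<longlongrightarrow> 0) at_top"
      unfolding g_def by (rule tendsto_mult_left_zero)
    show "\<bar>u t x - u t y\<bar> \<le> g t * (1 + \<beta> * (V x + V y))" if "s + 1 \<le> t" for t x y
      using one[OF that, of x y] one[OF that, of y x] by (simp add: abs_le_iff add.commute)
  qed
qed

section \<open>Convergence to the mean\<close>

lemma continuous_on_solution:
  assumes "s < t"
  shows "continuous_on UNIV (u t)"
proof -
  have "continuous_on ({s<..} \<times> UNIV) (\<lambda>(t, x). u t x)"
    using smooth by (auto simp: C12_after_def)
  moreover have "continuous_on UNIV (\<lambda>x :: real^'n. (t, x))" by (intro continuous_intros)
  moreover have "range (\<lambda>x :: real^'n. (t, x)) \<subseteq> {s<..} \<times> UNIV" using assms by auto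
  ultimately show ?thesis using continuous_on_compose2 by fastforce
qed

text \<open>\<open>u t x - m\<close> is the mean of \<open>u t x - u t y\<close> over \<open>y\<close> under \<open>\<mu> t\<close>. On a large ball the integrand
is small by the decay of the oscillation, and outside it is bounded while the ball carries almost all the mass,
for all \<open>t\<close> at once.\<close>

lemma tendsto_mean:
  assumes prob: "\<And>t. s \<le> t \<Longrightarrow> borel_prob (\<mu> t)" and tight: "tight_family \<mu>"
    and mean: "\<And>t. s \<le> t \<Longrightarrow> (\<integral>y. u t y \<partial>\<mu> t) = m"
  shows "((\<lambda>t. u t x) \<longlongrightarrow> m) at_top"
proof (rule tendstoI)
  fix \<epsilon> :: real assume \<epsilon>: "0 < \<epsilon>"
  obtain \<beta> g where g: "0 < \<beta>" "(g \<longlongrightarrow> 0) at_top"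
    "\<And>t x y. s + 1 \<le> t \<Longrightarrow> \<bar>u t x - u t y\<bar> \<le> g t * (1 + \<beta> * (V x + V y))"
    by (fact oscillation_decay)
  have U: "0 \<le> U" using bound[of s undefined] by simp
  define \<epsilon>' where "\<epsilon>' = \<epsilon> / (2 * (2 * U + 1))"
  have \<epsilon>': "0 < \<epsilon>'" "2 * U * \<epsilon>' \<le> \<epsilon> / 2"
    using \<epsilon> U by (auto simp: \<epsilon>'_def field_simps)
  then obtain R where R: "0 < R" "\<And>t. 0 \<le> t \<Longrightarrow> 1 - \<epsilon>' \<le> measure (\<mu> t) (ball 0 R)"
    using tight unfolding tight_family_def by meson
  obtain z where z: "\<And>y. norm y \<le> R \<Longrightarrow> V y \<le> V z"
    using V_max_on_ball[of R] R(1) by auto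
  define c' where "c' = 1 + \<beta> * (V x + V z)"
  have "((\<lambda>t. g t * c') \<longlongrightarrow> 0) at_top" using g(2) by (rule tendsto_mult_left_zero)
  then have "\<forall>\<^sub>F t in at_top. g t * c' < \<epsilon> / 2"
    using \<epsilon> by (intro order_tendstoD(2)) auto
  then show "\<forall>\<^sub>F t in at_top. dist (u t x) m < \<epsilon>"
    using eventually_ge_at_top[of "s + 1"]
  proof eventually_elim
    case (elim t)
    then have t: "s < t" "s \<le> t" "0 \<le> t" using s_nonneg by auto
    interpret prob_space "\<mu> t" using prob[OF t(2)] by (simp add: borel_prob_def)
    have sets: "sets (\<mu> t) = sets borel" using prob[OF t(2)] by (simp add: borel_prob_def)
    have space: "space (\<mu> t) = UNIV" using sets_eq_imp_space_eq[OF sets] by simp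
    have meas: "u t \<in> borel_measurable (\<mu> t)"
      using borel_measurable_continuous_onI[OF continuous_on_solution[OF t(1)]] measurable_cong_sets[OF sets refl] by blast
    have int: "integrable (\<mu> t) (u t)"
      by (rule integrable_const_bound[of _ U]) (use bound[OF t(2)] meas in auto)
    have ball: "ball 0 R \<in> sets (\<mu> t)" by (simp add: sets)
    have pt: "\<bar>u t x - u t y\<bar> \<le> g t * c' + 2 * U * indicator (- ball 0 R) y" for y
    proof (cases "norm y < R")
      case True
      have "0 \<le> g t * (1 + \<beta> * (V x + V y))" using g(3)[OF elim(2), of x y] by linarith
      then have g0: "0 \<le> g t"
        using g(1) V_pos[of x] V_pos[of y] by (smt (verit) mult_nonneg_nonneg zero_le_mult_iff)
      have "\<bar>u t x - u t y\<bar> \<le> g t * (1 + \<beta> * (V x + V y))" by (rule g(3)[OF elim(2)])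
      also have "\<dots> \<le> g t * c'"
        unfolding c'_def using g0 g(1) z[of y] True by (intro mult_left_mono add_left_mono) auto
      finally show ?thesis using True by simp
    next
      case False
      have "0 \<le> g t * (1 + \<beta> * (V x + V z))" using g(3)[OF elim(2), of x z] by linarith
      then show ?thesis
        using bound[OF t(2), of x] bound[OF t(2), of y] False by (simp add: c'_def)
    qed
    have "u t x - m = (\<integral>y. u t x - u t y \<partial>\<mu> t)"
      using int mean[OF t(2)] prob_space by simp
    then have "\<bar>u t x - m\<bar> \<le> (\<integral>y. \<bar>u t x - u t y\<bar> \<partial>\<mu> t)"
      using integral_abs_bound[of "\<mu> t" "\<lambda>y. u t x - u t y"] by simp
    also have "\<dots> \<le> (\<integral>y. g t * c' + 2 * U * indicator (- ball 0 R) y \<partial>\<mu> t)"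
    proof (rule integral_mono)
      show "integrable (\<mu> t) (\<lambda>y. \<bar>u t x - u t y\<bar>)" using int by auto
      show "integrable (\<mu> t) (\<lambda>y. g t * c' + 2 * U * indicator (- ball 0 R) y)"
        by (intro Bochner_Integration.integrable_add integrable_mult_right integrable_const integrable_real_indicator)
          (auto simp: sets less_top[symmetric])
    qed (use pt in simp)
    also have "\<dots> = g t * c' + 2 * U * measure (\<mu> t) (- ball 0 R)"
      using prob_space by (subst Bochner_Integration.integral_add)
        (auto simp: sets less_top[symmetric] space intro!: integrable_mult_right integrable_real_indicator)
    also have "measure (\<mu> t) (- ball 0 R) \<le> \<epsilon>'"
      using prob_compl[OF ball] R(2)[OF t(3)] by (simp add: space Compl_eq_Diff_UNIV)
    finally have "\<bar>u t x - m\<bar> \<le> g t * c' + 2 * U * \<epsilon>'"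
      using U by (simp add: mult_left_mono)
    with elim(1) \<epsilon>'(2) show ?case by (simp add: dist_real_def)
  qed
qed

end

lemma tends_in_Lp_bounded_convergence:
  assumes "prob_space M" and p: "0 < p"
    and meas: "\<forall>\<^sub>F t in at_top. g t \<in> borel_measurable M"
    and bd: "\<forall>\<^sub>F t in at_top. \<forall>x. \<bar>g t x\<bar> \<le> U"
    and lim: "\<And>x. ((\<lambda>t. g t x) \<longlongrightarrow> l) at_top"
  shows "tends_in_Lp p M g (\<lambda>_. l) (at_top :: real filter)"
proof -
  interpret prob_space M by fact
  have powr_bd: "\<bar>y\<bar> powr p \<le> K powr p" if "\<bar>y\<bar> \<le> K" for y K :: real
    using that p by (intro powr_mono2) auto
  have "mem_Lp p M (\<lambda>_. l)" by (simp add: mem_Lp_def)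
  moreover have "\<forall>\<^sub>F t in at_top. mem_Lp p M (g t)"
    using meas bd
  proof eventually_elim
    case (elim t)
    then have "integrable M (\<lambda>x. \<bar>g t x\<bar> powr p)"
      by (intro integrable_const_bound[of _ "U powr p"]) (auto intro!: powr_bd)
    with elim show ?case by (simp add: mem_Lp_def)
  qed
  moreover have "((\<lambda>t. Lp_norm p M (\<lambda>x. g t x - l)) \<longlongrightarrow> 0) at_top"
  proof -
    \<comment> \<open>Dominated convergence wants measurability for all \<open>t\<close>, so \<open>g t\<close> is replaced where it may fail.\<close>
    define h where "h t = (if g t \<in> borel_measurable M then (\<lambda>x. \<bar>g t x - l\<bar> powr p) else (\<lambda>_. 0))" for t
    have "((\<lambda>t. \<integral>x. h t x \<partial>M) \<longlongrightarrow> (\<integral>x. 0 \<partial>M)) at_top"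
    proof (rule integral_dominated_convergence_at_top[where w = "\<lambda>_. (U + \<bar>l\<bar>) powr p"])
      show "h t \<in> borel_measurable M" for t by (auto simp: h_def)
      show "AE x in M. ((\<lambda>t. h t x) \<longlongrightarrow> 0) at_top"
      proof (rule AE_I2)
        fix x
        have "((\<lambda>t. \<bar>g t x - l\<bar> powr p) \<longlongrightarrow> 0) at_top"
          using tendsto_rabs[OF tendsto_diff[OF lim[of x] tendsto_const[of l]]] p
          by (intro tendsto_zero_powrI[of _ _ _ p]) auto
        then show "((\<lambda>t. h t x) \<longlongrightarrow> 0) at_top"
          by (rule Lim_transform_eventually) (use meas in \<open>eventually_elim, simp add: h_def\<close>)
      qed
      show "\<forall>\<^sub>F t in at_top. AE x in M. norm (h t x) \<le> (U + \<bar>l\<bar>) powr p"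
        using bd
      proof eventually_elim
        case (elim t)
        have "\<bar>g t x - l\<bar> powr p \<le> (U + \<bar>l\<bar>) powr p" for x
          using elim[rule_format, of x] by (intro powr_bd) linarith
        then show ?case by (intro AE_I2) (auto simp: h_def)
      qed
    qed auto
    then have "((\<lambda>t. \<integral>x. h t x \<partial>M) \<longlongrightarrow> 0) at_top" by simp
    then have "((\<lambda>t. \<integral>x. \<bar>g t x - l\<bar> powr p \<partial>M) \<longlongrightarrow> 0) at_top"
      by (rule Lim_transform_eventually) (use meas in \<open>eventually_elim, simp add: h_def\<close>)
    then show ?thesis
      unfolding Lp_norm_def using p by (intro tendsto_zero_powrI[of _ _ _ "1 / p"]) auto
  qed
  ultimately show ?thesis by (simp add: tends_in_Lp_def)
qed

theorem theorem4p4: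
  fixes Q :: "real \<Rightarrow> real^'n \<Rightarrow> real^'n^'n"
    and b :: "real \<Rightarrow> real^'n \<Rightarrow> real^'n"
    and \<alpha> p\<^sub>0 :: real
    and \<eta> :: "real \<Rightarrow> real^'n \<Rightarrow> real"
    and V :: "real^'n \<Rightarrow> real"
    and a \<kappa> c\<^sub>0 r\<^sub>0 c :: real
    and Qinf :: "real^'n \<Rightarrow> real^'n^'n"
    and binf :: "real^'n \<Rightarrow> real^'n"
    and G :: "real \<Rightarrow> real \<Rightarrow> (real^'n \<Rightarrow> real) \<Rightarrow> real^'n \<Rightarrow> real"
    and T :: "real \<Rightarrow> (real^'n \<Rightarrow> real) \<Rightarrow> real^'n \<Rightarrow> real"
    and \<mu> :: "real \<Rightarrow> (real^'n) measure"
    and \<mu>inf :: "(real^'n) measure"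
    and s p :: real
    and f :: "real^'n \<Rightarrow> real"
  assumes "convergent_kolmogorov_family Q b \<alpha> p\<^sub>0 \<eta> V a \<kappa> c\<^sub>0 r\<^sub>0 c Qinf binf"
    and "evolution_operator Q b G"
    and "evolution_system_of_measures G \<mu>"
    and "tight_family \<mu>"
    and "semigroup_of Qinf binf T"
    and "is_the_invariant_measure T \<mu>inf"
    and "s \<ge> 0"
    and "p \<ge> 1"
    and "f \<in> bcontfun"
  shows "tends_in_Lp p \<mu>inf (\<lambda>t. G t s f) (\<lambda>_. \<integral>x. f x \<partial>\<mu> s) at_top"
proof -
  have sol: "bounded_classical_solution Q b s f (\<lambda>t. G t s f)"
    using assms(2,7,9) by (auto simp: evolution_operator_def is_the_bounded_classical_solution_def)
  then obtain U where U: "\<And>t x. (t, x) \<in> {s..} \<times> UNIV \<Longrightarrow> \<bar>G t s f x\<bar> \<le> U"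
    using Cb_on_bound[of "{s..} \<times> UNIV" "\<lambda>t. G t s f"] by (auto simp: bounded_classical_solution_def)
  interpret family: convergent_kolmogorov_family Q b \<alpha> p\<^sub>0 \<eta> V a \<kappa> c\<^sub>0 r\<^sub>0 c Qinf binf by fact
  interpret bounded_solution Q b \<alpha> p\<^sub>0 \<eta> V a \<kappa> c\<^sub>0 r\<^sub>0 c Qinf binf s "\<lambda>t. G t s f" U
    using sol U assms(7) by unfold_locales (auto simp: bounded_classical_solution_def)
  have inv: "prob_space \<mu>inf" "sets \<mu>inf = sets borel"
    using assms(6) by (auto simp: is_the_invariant_measure_def invariant_measure_def borel_prob_def)
  have "((\<lambda>t. G t s f x) \<longlongrightarrow> (\<integral>x. f x \<partial>\<mu> s)) at_top" for x
    using assms(3,7,9) by (intro tendsto_mean[OF _ assms(4)]) (auto simp: evolution_system_of_measures_def)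
  moreover have "\<forall>\<^sub>F t in at_top. G t s f \<in> borel_measurable \<mu>inf"
    using eventually_gt_at_top[of s]
  proof eventually_elim
    case (elim t)
    show ?case
      using borel_measurable_continuous_onI[OF continuous_on_solution[OF elim]] measurable_cong_sets[OF inv(2) refl] by blast
  qed
  moreover have "\<forall>\<^sub>F t in at_top. \<forall>x. \<bar>G t s f x\<bar> \<le> U"
    using eventually_ge_at_top[of s] by eventually_elim (use U in auto)
  ultimately show ?thesis
    using inv(1) assms(8) by (intro tends_in_Lp_bounded_convergence) auto
qed

end
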